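(* Let $\mathbb{F}$ be an arbitrary field and let $E$ be the natural $2$-dimensional representation of $\mathrm{SL}_2(\mathbb{F})$. Let $M, N, d \in \mathbb{N}_0$. Then there is an isomorphism of $\mathrm{SL}_2(\mathbb{F})$-representations $$\mathrm{Sym}_M\mathrm{Sym}^N E\otimes\mathrm{Sym}_{M+N}\mathrm{Sym}^d E \;\cong\; \mathrm{Sym}_N\mathrm{Sym}^{d}E\otimes\mathrm{Sym}_M\mathrm{Sym}^{d+N}E.$$
   Context: $\mathbb{N}_0=\{0,1,2,\ldots\}$. Upper symmetric powers: fixing a basis $X,Y$ of $E$, $\mathrm{Sym}^d E$ is the space of homogeneous polynomials of degree $d$ in $X,Y$ over $\mathbb{F}$, with action $\begin{pmatrix}\alpha&\beta\\ \gamma&\delta\end{pmatrix}\cdot P(X,Y) = P(\alpha X+\gamma Y,\beta X+\delta Y)$. Lower symmetric powers: for a finite-dimensional representation $V$ and $R\in\mathbb{N}_0$, $\mathrm{Sym}_R V = \{w\in V^{\otimes R} : \sigma\cdot w = w \text{ for all } \sigma\in\mathfrak{S}_R\}$, where the symmetric group $\mathfrak{S}_R$ acts by permuting tensor positions, a subrepresentation of $V^{\otimes R}$ with the diagonal action; $\mathrm{Sym}_0V=\mathbb{F}$. *)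

theory Defs
  imports
    "HOL-Analysis.Determinants"
    "HOL-Computational_Algebra.Polynomial"
    "HOL-Combinatorics.Permutations"
    "HOL-Library.Function_Algebras"
begin

section \<open>Representations and their isomorphisms\<close>

text \<open>
  The underlying vector space is the subspace \<open>vecs V\<close> of an ambient abelian group \<open>'v\<close> equipped
  with the scalar multiplication \<open>scl V\<close>; \<open>act V g\<close> is only meaningful on \<open>vecs V\<close>, for \<open>g\<close> in
  the group under consideration.
\<close>

record ('a, 'g, 'v) rep =
  vecs :: "'v set"
  scl :: "'a \<Rightarrow> 'v \<Rightarrow> 'v"
  act :: "'g \<Rightarrow> 'v \<Rightarrow> 'v"

definition rep_isomorphism ::
  "'g set \<Rightarrow> ('a, 'g, 'v::ab_group_add) rep \<Rightarrow> ('a, 'g, 'w::ab_group_add) rep \<Rightarrow> ('v \<Rightarrow> 'w) \<Rightarrow> bool"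
where
  "rep_isomorphism G V W \<phi> \<longleftrightarrow>
     bij_betw \<phi> (vecs V) (vecs W) \<and>
     (\<forall>x\<in>vecs V. \<forall>y\<in>vecs V. \<phi> (x + y) = \<phi> x + \<phi> y) \<and>
     (\<forall>c. \<forall>x\<in>vecs V. \<phi> (scl V c x) = scl W c (\<phi> x)) \<and>
     (\<forall>g\<in>G. \<forall>x\<in>vecs V. \<phi> (act V g x) = act W g (\<phi> x))"

definition rep_isomorphic ::
  "'g set \<Rightarrow> ('a, 'g, 'v::ab_group_add) rep \<Rightarrow> ('a, 'g, 'w::ab_group_add) rep \<Rightarrow> bool"
where
  "rep_isomorphic G V W \<longleftrightarrow> (\<exists>\<phi>. rep_isomorphism G V W \<phi>)"


section \<open>Tensor products\<close>

text \<open>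
  A tensor is realised as a functional on (multi)linear forms: the pure tensor
  \<open>v\<^sub>1 \<otimes> \<dots> \<otimes> v\<^sub>R\<close> is evaluation \<open>B \<mapsto> B(v\<^sub>1,\<dots>,v\<^sub>R)\<close>, and the tensor product is the span of the pure
  tensors. Over a field this is the usual tensor product; its universal property is
  proved at the end of this theory. Functionals are set to 0 on functions
  that are not (multi)linear forms, so that equality of tensors is equality of functions.
\<close>

definition fscale :: "'a::times \<Rightarrow> ('x \<Rightarrow> 'a) \<Rightarrow> 'x \<Rightarrow> 'a" where
  "fscale c f = (\<lambda>x. c * f x)"

definition pure_tensor :: "(('x \<Rightarrow> 'a::zero) \<Rightarrow> bool) \<Rightarrow> 'x \<Rightarrow> ('x \<Rightarrow> 'a) \<Rightarrow> 'a" where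
  "pure_tensor \<B> x = (\<lambda>B. if \<B> B then B x else 0)"

text \<open>The linear map on tensors determined by \<open>pure_tensor \<B> x \<mapsto> pure_tensor \<B> (\<psi> x)\<close>.\<close>

definition push :: "(('x \<Rightarrow> 'a::zero) \<Rightarrow> bool) \<Rightarrow> ('x \<Rightarrow> 'x) \<Rightarrow> (('x \<Rightarrow> 'a) \<Rightarrow> 'a) \<Rightarrow> ('x \<Rightarrow> 'a) \<Rightarrow> 'a" where
  "push \<B> \<psi> t = (\<lambda>B. if \<B> B then t (B \<circ> \<psi>) else 0)"

lemma push_pure_tensor:
  assumes "\<And>B. \<B> B \<Longrightarrow> \<B> (B \<circ> \<psi>)"
  shows "push \<B> \<psi> (pure_tensor \<B> x) = pure_tensor \<B> (\<psi> x)"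
  using assms by (auto simp: push_def pure_tensor_def fun_eq_iff)

definition bilinear_into ::
  "('a, 'g, 'v::ab_group_add) rep \<Rightarrow> ('a, 'g, 'w::ab_group_add) rep \<Rightarrow>
   ('a \<Rightarrow> 'u \<Rightarrow> 'u::ab_group_add) \<Rightarrow> ('v \<times> 'w \<Rightarrow> 'u) \<Rightarrow> bool"
where
  "bilinear_into V W s f \<longleftrightarrow>
     (\<forall>x\<in>vecs V. \<forall>y\<in>vecs V. \<forall>z\<in>vecs W. f (x + y, z) = f (x, z) + f (y, z)) \<and>
     (\<forall>x\<in>vecs V. \<forall>y\<in>vecs W. \<forall>z\<in>vecs W. f (x, y + z) = f (x, y) + f (x, z)) \<and>
     (\<forall>c. \<forall>x\<in>vecs V. \<forall>y\<in>vecs W. f (scl V c x, y) = s c (f (x, y)) \<and> f (x, scl W c y) = s c (f (x, y)))"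

definition tuples :: "nat \<Rightarrow> ('a, 'g, 'v) rep \<Rightarrow> 'v list set" where
  "tuples R V = {vs. length vs = R \<and> set vs \<subseteq> vecs V}"

definition multilinear_into ::
  "nat \<Rightarrow> ('a, 'g, 'v::ab_group_add) rep \<Rightarrow>
   ('a \<Rightarrow> 'u \<Rightarrow> 'u::ab_group_add) \<Rightarrow> ('v list \<Rightarrow> 'u) \<Rightarrow> bool"
where
  "multilinear_into R V s f \<longleftrightarrow>
     (\<forall>vs\<in>tuples R V. \<forall>i<R. \<forall>x\<in>vecs V. \<forall>y\<in>vecs V.
        f (vs[i := x + y]) = f (vs[i := x]) + f (vs[i := y])) \<and>
     (\<forall>vs\<in>tuples R V. \<forall>i<R. \<forall>c. \<forall>x\<in>vecs V. f (vs[i := scl V c x]) = s c (f (vs[i := x])))"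

definition tensor ::
  "('a::field, 'g, 'v::ab_group_add) rep \<Rightarrow> ('a, 'g, 'w::ab_group_add) rep \<Rightarrow>
   ('a, 'g, ('v \<times> 'w \<Rightarrow> 'a) \<Rightarrow> 'a) rep"  (infixr "\<otimes>" 70)
where
  "V \<otimes> W =
     \<lparr>vecs = module.span fscale (pure_tensor (bilinear_into V W (*)) ` (vecs V \<times> vecs W)),
      scl = fscale,
      act = (\<lambda>g. push (bilinear_into V W (*)) (map_prod (act V g) (act W g)))\<rparr>"

definition tensor_power ::
  "nat \<Rightarrow> ('a::field, 'g, 'v::ab_group_add) rep \<Rightarrow> ('a, 'g, ('v list \<Rightarrow> 'a) \<Rightarrow> 'a) rep"
where
  "tensor_power R V =
     \<lparr>vecs = module.span fscale (pure_tensor (multilinear_into R V (*)) ` tuples R V),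
      scl = fscale,
      act = (\<lambda>g. push (multilinear_into R V (*)) (map (act V g)))\<rparr>"


section \<open>Symmetric powers\<close>

text \<open>\<open>\<sigma> \<cdot> (v\<^sub>0 \<otimes> \<dots> \<otimes> v\<^sub>R\<^sub>-\<^sub>1)\<close> has \<open>v\<^sub>i\<close> in position \<open>\<sigma> i\<close>.\<close>

definition permute_tensor ::
  "nat \<Rightarrow> ('a::field, 'g, 'v::ab_group_add) rep \<Rightarrow> (nat \<Rightarrow> nat) \<Rightarrow>
   (('v list \<Rightarrow> 'a) \<Rightarrow> 'a) \<Rightarrow> ('v list \<Rightarrow> 'a) \<Rightarrow> 'a"
where
  "permute_tensor R V \<sigma> = push (multilinear_into R V (*)) (permute_list (inv \<sigma>))"

definition Sym_lower ::
  "nat \<Rightarrow> ('a::field, 'g, 'v::ab_group_add) rep \<Rightarrow> ('a, 'g, ('v list \<Rightarrow> 'a) \<Rightarrow> 'a) rep"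
where
  "Sym_lower R V =
     (tensor_power R V)
       \<lparr>vecs := {w \<in> vecs (tensor_power R V). \<forall>\<sigma>. \<sigma> permutes {..<R} \<longrightarrow> permute_tensor R V \<sigma> w = w}\<rparr>"

definition SL2 :: "('a::field ^ 2 ^ 2) set" where
  "SL2 = {g. det g = 1}"

text \<open>
  \<open>\<F>[X,Y]\<close> is the type \<open>'a poly poly\<close>: \<open>Y\<close> is the outer and \<open>X\<close> the inner variable, so the
  coefficient of \<open>X\<^sup>i Y\<^sup>j\<close> in \<open>P\<close> is \<open>coeff (coeff P j) i\<close>.
\<close>

definition X_var :: "'a::field poly poly" where "X_var = [:[:0, 1:]:]"
definition Y_var :: "'a::field poly poly" where "Y_var = [:0, 1:]"

definition pscale :: "'a::field \<Rightarrow> 'a poly poly \<Rightarrow> 'a poly poly" where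
  "pscale c = smult [:c:]"

definition subst_XY :: "'a::field poly poly \<Rightarrow> 'a poly poly \<Rightarrow> 'a poly poly \<Rightarrow> 'a poly poly" where
  "subst_XY P U V =
     (\<Sum>j\<le>degree P. \<Sum>i\<le>degree (coeff P j). pscale (coeff (coeff P j) i) (U ^ i * V ^ j))"

text \<open>\<open>Sym_upper_E d\<close> is \<open>Sym\<^sup>d E\<close> for the natural representation \<open>E\<close> with basis \<open>X, Y\<close>.\<close>

definition Sym_upper_E :: "nat \<Rightarrow> ('a::field, 'a ^ 2 ^ 2, 'a poly poly) rep" where
  "Sym_upper_E d =
     \<lparr>vecs = {P. \<forall>i j. coeff (coeff P j) i \<noteq> 0 \<longrightarrow> i + j = d},
      scl = pscale,
      act = (\<lambda>g P. subst_XY P (pscale (g$1$1) X_var + pscale (g$2$1) Y_var)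
                              (pscale (g$1$2) X_var + pscale (g$2$2) Y_var))\<rparr>"


section \<open>The universal property of tensor products\<close>

lemma vector_space_fscale: "vector_space (fscale :: 'a::field \<Rightarrow> ('x \<Rightarrow> 'a) \<Rightarrow> _)"
  by unfold_locales (auto simp: fscale_def fun_eq_iff algebra_simps)

lemma vector_space_field: "vector_space ((*) :: 'a::field \<Rightarrow> _)"
  by unfold_locales (auto simp: algebra_simps)

lemma pure_tensor_universal:
  fixes s :: "'a::field \<Rightarrow> 'u::ab_group_add \<Rightarrow> 'u" and \<B> :: "('x \<Rightarrow> 'a) \<Rightarrow> bool"
  assumes s: "vector_space s"
    and f: "\<And>l. Vector_Spaces.linear s (*) l \<Longrightarrow> \<B> (l \<circ> f)"
  shows "\<exists>L. Vector_Spaces.linear fscale s L \<and> (\<forall>x\<in>S. L (pure_tensor \<B> x) = f x)"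
proof -
  interpret U: vector_space s by fact
  interpret T: vector_space "fscale :: 'a \<Rightarrow> (('x \<Rightarrow> 'a) \<Rightarrow> 'a) \<Rightarrow> _" by (rule vector_space_fscale)
  interpret K: vector_space "(*) :: 'a \<Rightarrow> _" by (rule vector_space_field)
  interpret TU: vector_space_pair "fscale :: 'a \<Rightarrow> (('x \<Rightarrow> 'a) \<Rightarrow> 'a) \<Rightarrow> _" s ..
  interpret UK: vector_space_pair s "(*) :: 'a \<Rightarrow> _" ..
  obtain D where D: "D \<subseteq> pure_tensor \<B> ` S" "T.independent D" "pure_tensor \<B> ` S \<subseteq> T.span D"
    using T.maximal_independent_subset[of "pure_tensor \<B> ` S"] by blast
  have "\<forall>b\<in>D. \<exists>x. pure_tensor \<B> x = b" using D(1) by auto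
  then obtain r where r: "\<And>b. b \<in> D \<Longrightarrow> pure_tensor \<B> (r b) = b" by metis
  obtain L where L: "Vector_Spaces.linear fscale s L" "\<forall>b\<in>D. L b = f (r b)"
    using TU.linear_independent_extend[OF D(2), of "f \<circ> r"] by auto
  interpret L: Vector_Spaces.linear fscale s L by fact
  have "L (pure_tensor \<B> x) = f x" if "x \<in> S" for x
  proof (rule ccontr)
    assume ne: "L (pure_tensor \<B> x) \<noteq> f x"
    define u where "u = L (pure_tensor \<B> x) - f x"
    have "U.independent {u}" using ne by (simp add: u_def)
    then obtain l where l: "Vector_Spaces.linear s (*) l" "l u = 1"
      using UK.linear_independent_extend[of "{u}" "\<lambda>_. 1"] by auto
    interpret l: Vector_Spaces.linear s "(*)" l by fact
    have "pure_tensor \<B> x \<in> T.span D" using D(3) that by blast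
    then obtain c A where A: "finite A" "A \<subseteq> D" "pure_tensor \<B> x = (\<Sum>a\<in>A. fscale (c a) a)"
      unfolding T.span_explicit by blast
    have ap: "(\<Sum>a\<in>A. F a) B = (\<Sum>a\<in>A. F a B)" for F :: "_ \<Rightarrow> ('x \<Rightarrow> 'a) \<Rightarrow> 'a" and B
      by (induction A rule: infinite_finite_induct) auto
    have "l (f x) = pure_tensor \<B> x (l \<circ> f)" using f[OF l(1)] by (simp add: pure_tensor_def)
    also have "\<dots> = (\<Sum>a\<in>A. c a * a (l \<circ> f))"
      unfolding A(3) ap by (simp add: fscale_def)
    also have "\<dots> = (\<Sum>a\<in>A. c a * l (f (r a)))"
    proof (rule sum.cong[OF refl])
      fix a assume "a \<in> A"
      then have "a = pure_tensor \<B> (r a)" using r A(2) by auto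
      then have "a (l \<circ> f) = pure_tensor \<B> (r a) (l \<circ> f)" by simp
      then show "c a * a (l \<circ> f) = c a * l (f (r a))"
        using f[OF l(1)] by (simp add: pure_tensor_def)
    qed
    also have "\<dots> = l (L (pure_tensor \<B> x))"
      unfolding A(3) L.sum L.scale l.sum l.scale
      using A(2) L(2) by (intro sum.cong) auto
    finally have "l u = 0" by (simp add: u_def l.diff)
    then show False using l(2) by simp
  qed
  then show ?thesis using L(1) by blast
qed

lemma bilinear_pure_tensor:
  fixes V :: "('a::field, 'g, 'v::ab_group_add) rep" and W :: "('a, 'g, 'w::ab_group_add) rep"
  shows "bilinear_into V W fscale (pure_tensor (bilinear_into V W (*)))"
  unfolding bilinear_into_def[of V W fscale]
  by (auto simp: pure_tensor_def fscale_def fun_eq_iff) (auto simp: bilinear_into_def)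

lemma multilinear_pure_tensor:
  fixes V :: "('a::field, 'g, 'v::ab_group_add) rep"
  shows "multilinear_into R V fscale (pure_tensor (multilinear_into R V (*)))"
  unfolding multilinear_into_def[of R V fscale]
  by (auto simp: pure_tensor_def fscale_def fun_eq_iff) (auto simp: multilinear_into_def)

theorem tensor_universal:
  fixes V :: "('a::field, 'g, 'v::ab_group_add) rep" and W :: "('a, 'g, 'w::ab_group_add) rep"
    and s :: "'a \<Rightarrow> 'u::ab_group_add \<Rightarrow> 'u"
  assumes "vector_space s" "bilinear_into V W s f"
  shows "\<exists>L. Vector_Spaces.linear fscale s L \<and>
           (\<forall>v\<in>vecs V. \<forall>w\<in>vecs W. L (pure_tensor (bilinear_into V W (*)) (v, w)) = f (v, w))"
proof -
  have "bilinear_into V W (*) (l \<circ> f)" if "Vector_Spaces.linear s (*) l" for l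
  proof -
    interpret l: Vector_Spaces.linear s "(*)" l by fact
    show ?thesis using assms(2) by (simp add: bilinear_into_def l.add l.scale)
  qed
  from pure_tensor_universal[where f = f and S = "vecs V \<times> vecs W" and \<B> = "bilinear_into V W (*)",
      OF assms(1) this] show ?thesis by auto
qed

theorem tensor_power_universal:
  fixes V :: "('a::field, 'g, 'v::ab_group_add) rep" and s :: "'a \<Rightarrow> 'u::ab_group_add \<Rightarrow> 'u"
  assumes "vector_space s" "multilinear_into R V s f"
  shows "\<exists>L. Vector_Spaces.linear fscale s L \<and>
           (\<forall>vs\<in>tuples R V. L (pure_tensor (multilinear_into R V (*)) vs) = f vs)"
proof -
  have "multilinear_into R V (*) (l \<circ> f)" if "Vector_Spaces.linear s (*) l" for l
  proof -
    interpret l: Vector_Spaces.linear s "(*)" l by fact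
    show ?thesis using assms(2) by (simp add: multilinear_into_def l.add l.scale)
  qed
  from pure_tensor_universal[where f = f and \<B> = "multilinear_into R V (*)", OF assms(1) this] show ?thesis .
qed

end

theory Submission
  imports Defs
begin

text \<open>
  An element of \<open>Sym\<^sub>R Sym\<^sup>d E\<close> is a symmetric polynomial in \<open>R\<close> points of the plane, homogeneous of
  degree \<open>d\<close> in each point. In these terms the isomorphism is multiplication,
  \<open>f \<otimes> h \<mapsto> f(x) h(x, y)\<close>, where \<open>x\<close> stands for \<open>M\<close> points and \<open>y\<close> for \<open>N\<close> points: the product has
  degree \<open>d + N\<close> in each point of \<open>x\<close> and \<open>d\<close> in each point of \<open>y\<close>, and it is symmetric in \<open>x\<close> and in \<open>y\<close>.

  For injectivity, suppose \<open>\<Sum> f\<^sub>i(x) h\<^sub>i(x, y) = 0\<close> with linearly independent \<open>f\<^sub>i\<close>, and fix \<open>M + N\<close>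
  distinct points \<open>z\<close>. As the \<open>h\<^sub>i\<close> are symmetric, \<open>\<Sum> h\<^sub>i(z) f\<^sub>i\<close> vanishes at all \<open>M\<close>-tuples of distinct
  members of \<open>z\<close>; a polynomial in \<open>M\<close> variables of degree at most \<open>N\<close> in each of them with this
  property is zero, so every \<open>h\<^sub>i(z)\<close> is zero. Both sides have dimension
  \<open>(d + M + N)! / (d! M! N!)\<close>. Points have coordinates in the infinite domain \<open>\<F>[X,Y]\<close>, which allows
  polynomials to be treated as functions even when \<open>\<F>\<close> is finite.
\<close>

section \<open>Substitution into binary forms\<close>

lemma poly_altdef_le:
  fixes p :: "'a::comm_semiring_1 poly"
  assumes "degree p \<le> k"
  shows "poly p x = (\<Sum>i\<le>k. coeff p i * x ^ i)"
  unfolding poly_altdef using assms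
  by (intro sum.mono_neutral_left) (auto simp: coeff_eq_0)

lemma map_poly_add_hom:
  assumes "h 0 = 0" "\<And>x y. h (x + y) = h x + h y"
  shows "map_poly h (p + q) = map_poly h p + map_poly h q"
  by (rule poly_eqI) (simp add: coeff_map_poly assms)

lemma map_poly_mult_hom:
  fixes h :: "'a::comm_semiring_0 \<Rightarrow> 'b::comm_semiring_0"
  assumes "h 0 = 0" "\<And>x y. h (x + y) = h x + h y" "\<And>x y. h (x * y) = h x * h y"
  shows "map_poly h (p * q) = map_poly h p * map_poly h q"
proof (rule poly_eqI)
  fix n
  have "h (sum f A) = (\<Sum>a\<in>A. h (f a))" for f :: "nat \<Rightarrow> 'a" and A
    by (induction A rule: infinite_finite_induct) (auto simp: assms)
  then show "coeff (map_poly h (p * q)) n = coeff (map_poly h p * map_poly h q) n"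
    by (simp add: coeff_map_poly coeff_mult assms)
qed

lemma vector_space_pscale: "vector_space (pscale :: 'a::field \<Rightarrow> _)"
proof
  fix c b :: 'a and x y :: "'a poly poly"
  show "pscale c (x + y) = pscale c x + pscale c y" by (simp add: pscale_def smult_add_right)
  show "pscale (c + b) x = pscale c x + pscale b x" by (simp add: pscale_def flip: smult_add_left)
  show "pscale c (pscale b x) = pscale (c * b) x" by (simp add: pscale_def mult.commute)
  show "pscale 1 x = x" by (simp add: pscale_def flip: one_pCons)
qed

interpretation pscale: vector_space "pscale :: 'a::field \<Rightarrow> _" by (rule vector_space_pscale)

lemma pscale_mult_left: "pscale c p * q = pscale c (p * q)"
  and pscale_mult_right: "p * pscale c q = pscale c (p * q)"
  by (simp_all add: pscale_def)

lemma coeff_pscale: "coeff (coeff (pscale c P) j) i = c * coeff (coeff P j) i"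
  by (simp add: pscale_def)

lemma coeff_sum2: "coeff (coeff (sum f A) j) i = (\<Sum>a\<in>A. coeff (coeff (f a) j) i)"
  by (simp add: coeff_sum)

text \<open>The algebra homomorphism from polynomials in \<open>X\<close> to binary polynomials that
  fixes constants and sends \<open>X\<close> to \<open>U\<close>.\<close>

definition XY_hom :: "'a::field poly poly \<Rightarrow> 'a poly \<Rightarrow> 'a poly poly" where
  "XY_hom U q = poly (map_poly (\<lambda>c. [:[:c:]:]) q) U"

lemma XY_hom_0 [simp]: "XY_hom U 0 = 0"
  by (simp add: XY_hom_def)

lemma XY_hom_add: "XY_hom U (p + q) = XY_hom U p + XY_hom U q"
  unfolding XY_hom_def by (subst map_poly_add_hom) auto

lemma XY_hom_mult: "XY_hom U (p * q) = XY_hom U p * XY_hom U q"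
  unfolding XY_hom_def by (subst map_poly_mult_hom) auto

text \<open>The double sum has bounds that depend on \<open>P\<close>, which is awkward for sums and
  products. As two nested evaluations, substitution inherits additivity and multiplicativity from
  \<open>map_poly\<close> and \<open>poly\<close>.\<close>

lemma subst_XY_poly: "subst_XY P U V = poly (map_poly (XY_hom U) P) V"
proof -
  have "XY_hom U q = (\<Sum>i\<le>degree q. pscale (coeff q i) (U ^ i))" for q :: "'a poly"
    unfolding XY_hom_def
    by (subst poly_altdef_le[OF map_poly_degree_leq]) (simp add: coeff_map_poly pscale_def)
  then show ?thesis
    unfolding subst_XY_def
    by (subst poly_altdef_le[OF map_poly_degree_leq])
      (simp add: coeff_map_poly sum_distrib_right pscale_mult_left)
qed

lemma subst_XY_add: "subst_XY (P + Q) U V = subst_XY P U V + subst_XY Q U V"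
  unfolding subst_XY_poly by (subst map_poly_add_hom) (auto simp: XY_hom_add)

lemma subst_XY_mult: "subst_XY (P * Q) U V = subst_XY P U V * subst_XY Q U V"
  unfolding subst_XY_poly by (subst map_poly_mult_hom) (auto simp: XY_hom_add XY_hom_mult)

lemma subst_XY_const: "subst_XY [:[:c:]:] U V = [:[:c:]:]"
  by (cases "c = 0") (simp_all add: subst_XY_def pscale_def)

lemma subst_XY_pscale: "subst_XY (pscale c P) U V = pscale c (subst_XY P U V)"
proof -
  have "pscale c P = [:[:c:]:] * P" for P by (simp add: pscale_def)
  then show ?thesis by (simp only: subst_XY_mult subst_XY_const)
qed

lemma subst_XY_0 [simp]: "subst_XY 0 U V = 0"
  by (simp add: subst_XY_def pscale_def)

lemma subst_XY_sum: "subst_XY (sum f A) U V = (\<Sum>a\<in>A. subst_XY (f a) U V)"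
  by (induction A rule: infinite_finite_induct) (auto simp: subst_XY_add)

lemma subst_XY_power: "subst_XY (P ^ n) U V = subst_XY P U V ^ n"
proof (induction n)
  case 0
  show ?case using subst_XY_const[of 1] by (simp flip: one_pCons)
qed (simp add: subst_XY_mult)

lemma subst_XY_X [simp]: "subst_XY X_var U V = U"
  and subst_XY_Y [simp]: "subst_XY Y_var U V = V"
  by (simp_all add: X_var_def Y_var_def subst_XY_def pscale_def flip: one_pCons)

text \<open>Only the inner \<open>subst_XY P A B\<close> is expanded; the outer substitution then
  passes through its sums, products and powers. This later moves a matrix from a form to the point
  where the form is evaluated.\<close>

lemma subst_XY_subst_XY:
  "subst_XY (subst_XY P A B) U V = subst_XY P (subst_XY A U V) (subst_XY B U V)"
  by (simp add: subst_XY_def[of P] subst_XY_sum subst_XY_pscale subst_XY_mult subst_XY_power)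

lemma coeff_mult2:
  "coeff (coeff (P * Q) n) m = (\<Sum>j\<le>n. \<Sum>i\<le>m. coeff (coeff P j) i * coeff (coeff Q (n - j)) (m - i))"
  by (simp add: coeff_mult coeff_sum)

section \<open>Homogeneous forms: closure under products and linear substitution\<close>

lemma vecs_Sym_upper_E:
  "P \<in> vecs (Sym_upper_E d) \<longleftrightarrow> (\<forall>i j. coeff (coeff P j) i \<noteq> 0 \<longrightarrow> i + j = d)"
  by (simp add: Sym_upper_E_def)

lemma scl_Sym_upper_E [simp]: "scl (Sym_upper_E d) = pscale"
  by (simp add: Sym_upper_E_def)

lemma subspace_Sym_upper_E: "pscale.subspace (vecs (Sym_upper_E d))"
proof (rule pscale.subspaceI)
  fix P Q :: "'a poly poly"
  assume PQ: "P \<in> vecs (Sym_upper_E d)" "Q \<in> vecs (Sym_upper_E d)"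
  have "coeff (coeff P j) i \<noteq> 0 \<or> coeff (coeff Q j) i \<noteq> 0" if "coeff (coeff (P + Q) j) i \<noteq> 0"
      for i j
    using that by auto
  then show "P + Q \<in> vecs (Sym_upper_E d)" using PQ unfolding vecs_Sym_upper_E by blast
qed (auto simp: vecs_Sym_upper_E coeff_pscale)

lemma mult_Sym_upper_E:
  assumes "P \<in> vecs (Sym_upper_E a)" "Q \<in> vecs (Sym_upper_E b)"
  shows "P * Q \<in> vecs (Sym_upper_E (a + b))"
  unfolding vecs_Sym_upper_E
proof (intro allI impI)
  fix i j assume "coeff (coeff (P * Q) j) i \<noteq> 0"
  then obtain j' where j': "j' \<le> j"
    "(\<Sum>i'\<le>i. coeff (coeff P j') i' * coeff (coeff Q (j - j')) (i - i')) \<noteq> 0"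
    unfolding coeff_mult2 by (meson atMost_iff sum.not_neutral_contains_not_neutral)
  then obtain i' where i': "i' \<le> i"
    "coeff (coeff P j') i' * coeff (coeff Q (j - j')) (i - i') \<noteq> 0"
    by (meson atMost_iff sum.not_neutral_contains_not_neutral)
  then have "i' + j' = a" "(i - i') + (j - j') = b"
    using assms unfolding vecs_Sym_upper_E by auto
  then show "i + j = a + b" using i'(1) j'(1) by linarith
qed

lemma power_Sym_upper_E:
  assumes "P \<in> vecs (Sym_upper_E a)" shows "P ^ n \<in> vecs (Sym_upper_E (n * a))"
proof (induction n)
  case 0
  show ?case by (auto simp: vecs_Sym_upper_E coeff_1 split: if_splits)
next
  case (Suc n)
  then show ?case using mult_Sym_upper_E[OF assms Suc] by simp
qed

lemma XY_Sym_upper_E: "X_var \<in> vecs (Sym_upper_E 1)" "Y_var \<in> vecs (Sym_upper_E 1)"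
  by (auto simp: vecs_Sym_upper_E X_var_def Y_var_def coeff_pCons split: nat.splits if_splits)

lemma subst_XY_Sym_upper_E:
  assumes P: "P \<in> vecs (Sym_upper_E d)" and U: "U \<in> vecs (Sym_upper_E 1)"
      and V: "V \<in> vecs (Sym_upper_E 1)"
  shows "subst_XY P U V \<in> vecs (Sym_upper_E d)"
proof -
  have "pscale (coeff (coeff P j) i) (U ^ i * V ^ j) \<in> vecs (Sym_upper_E d)" for i j
  \<comment> \<open>The double sum of \<open>subst_XY\<close> also runs over pairs with
    \<open>i + j\<close> different from \<open>d\<close>; those terms have coefficient zero.\<close>
  proof (cases "coeff (coeff P j) i = 0")
    case True
    then show ?thesis by (simp add: pscale.subspace_0[OF subspace_Sym_upper_E])
  next
    case False
    then have "i + j = d" using P by (simp add: vecs_Sym_upper_E)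
    then have "U ^ i * V ^ j \<in> vecs (Sym_upper_E d)"
      using mult_Sym_upper_E[OF power_Sym_upper_E[OF U] power_Sym_upper_E[OF V], of i j] by simp
    then show ?thesis by (rule pscale.subspace_scale[OF subspace_Sym_upper_E])
  qed
  then show ?thesis
    unfolding subst_XY_def by (intro pscale.subspace_sum[OF subspace_Sym_upper_E])
qed

definition lin_X :: "'a::field ^ 2 ^ 2 \<Rightarrow> 'a poly poly" where
  "lin_X g = pscale (g$1$1) X_var + pscale (g$2$1) Y_var"
definition lin_Y :: "'a::field ^ 2 ^ 2 \<Rightarrow> 'a poly poly" where
  "lin_Y g = pscale (g$1$2) X_var + pscale (g$2$2) Y_var"

lemma act_Sym_upper_E: "act (Sym_upper_E d) g P = subst_XY P (lin_X g) (lin_Y g)"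
  by (simp add: Sym_upper_E_def lin_X_def lin_Y_def)

lemma act_in_Sym_upper_E:
  assumes "P \<in> vecs (Sym_upper_E d)" shows "act (Sym_upper_E d) g P \<in> vecs (Sym_upper_E d)"
  unfolding act_Sym_upper_E lin_X_def lin_Y_def using assms
  by (intro subst_XY_Sym_upper_E pscale.subspace_add[OF subspace_Sym_upper_E]
      pscale.subspace_scale[OF subspace_Sym_upper_E] XY_Sym_upper_E)

section \<open>The monomial basis of the space of binary forms\<close>

definition hmonom :: "nat \<Rightarrow> nat \<Rightarrow> 'a::field poly poly" where
  "hmonom d i = X_var ^ i * Y_var ^ (d - i)"

lemma hmonom_monom: "(hmonom d i :: 'a::field poly poly) = monom (monom 1 i) (d - i)"
proof -
  have "(X_var :: 'a poly poly) ^ i = [:monom 1 i:]" for i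
    by (induction i) (auto simp: X_var_def monom_Suc monom_0 one_pCons)
  moreover have "(Y_var :: 'a poly poly) ^ i = monom 1 i" for i
    by (induction i) (auto simp: Y_var_def monom_Suc monom_0 simp flip: one_pCons)
  ultimately show ?thesis by (simp add: hmonom_def smult_monom flip: one_pCons)
qed

lemma hmonom_in: "i \<le> d \<Longrightarrow> hmonom d i \<in> vecs (Sym_upper_E d)"
  by (auto simp: hmonom_monom vecs_Sym_upper_E split: if_splits)

lemma Sym_upper_E_expand:
  assumes "P \<in> vecs (Sym_upper_E d)"
  shows "P = (\<Sum>i\<le>d. pscale (coeff (coeff P (d - i)) i) (hmonom d i))"
proof (intro poly_eqI)
  fix j i
  have *: "d - k = j \<and> k = i \<longleftrightarrow> k = i \<and> i + j = d" if "k \<le> d" for k using that by auto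
  have "(\<Sum>k\<le>d. coeff (coeff P (d - k)) k * coeff (coeff (hmonom d k) j) i) =
    (\<Sum>k\<le>d. if k = i then (if i + j = d then coeff (coeff P j) i else 0) else 0)"
    by (intro sum.cong) (auto simp: hmonom_monom)
  then show "coeff (coeff P j) i =
      coeff (coeff (\<Sum>i\<le>d. pscale (coeff (coeff P (d - i)) i) (hmonom d i)) j) i"
    using assms by (auto simp: coeff_sum2 coeff_pscale vecs_Sym_upper_E)
qed

section \<open>Monomial tensors and their orbit sums\<close>

interpretation fscale: vector_space "fscale :: 'a::field \<Rightarrow> ('x \<Rightarrow> 'a) \<Rightarrow> _"
    by (rule vector_space_fscale)

definition exps :: "nat \<Rightarrow> nat \<Rightarrow> nat list set" where
  "exps R d = {e. length e = R \<and> set e \<subseteq> {..d}}"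

lemma finite_exps [simp]: "finite (exps R d)"
  using finite_lists_length_eq[of "{..d}" R] by (simp add: exps_def conj_commute)

lemma exps_0: "exps 0 d = {[]}"
  by (auto simp: exps_def)

lemma sum_exps_Suc: "(\<Sum>e\<in>exps (Suc R) d. F e) = (\<Sum>k\<le>d. \<Sum>e\<in>exps R d. F (k # e))"
proof -
  have "bij_betw (\<lambda>(k, e). k # e) ({..d} \<times> exps R d) (exps (Suc R) d)"
    by (rule bij_betwI[where g = "\<lambda>e. (hd e, tl e)"]) (auto simp: exps_def length_Suc_conv)
  from sum.reindex_bij_betw[OF this, of F] show ?thesis
    by (simp add: sum.cartesian_product case_prod_unfold)
qed

lemma exps_length: "e \<in> exps R d \<Longrightarrow> length e = R"
  by (simp add: exps_def)

text \<open>The coordinate form dual to the monomial tensor with \<open>X\<close>-exponents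
  \<open>e\<close>. The value 0 on lists of the wrong length lets \<open>mono_coeff_permute\<close>
  be an equality of functions on all lists.\<close>

definition mono_coeff :: "nat \<Rightarrow> nat list \<Rightarrow> 'a::field poly poly list \<Rightarrow> 'a" where
  "mono_coeff d e vs =
     (if length vs = length e then \<Prod>i<length e. coeff (coeff (vs ! i) (d - e ! i)) (e ! i) else 0)"

lemma prod_list_update:
  assumes "i < R" "length vs = R"
  shows "(\<Prod>j<R. h j (vs[i := x] ! j)) = h i x * (\<Prod>j\<in>{..<R} - {i}. h j (vs ! j))"
proof -
  have "(\<Prod>j<R. h j (vs[i := x] ! j)) =
      h i (vs[i := x] ! i) * (\<Prod>j\<in>{..<R} - {i}. h j (vs[i := x] ! j))"
    using assms by (intro prod.remove) auto
  also have "\<dots> = h i x * (\<Prod>j\<in>{..<R} - {i}. h j (vs ! j))"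
    using assms by (intro arg_cong2[where f = "(*)"] prod.cong) auto
  finally show ?thesis .
qed

lemma multilinear_mono_coeff:
  "length e = R \<Longrightarrow> multilinear_into R (Sym_upper_E d) (*) (mono_coeff d e)"
  unfolding multilinear_into_def mono_coeff_def
  by (auto simp: tuples_def prod_list_update[where h = "\<lambda>j v. coeff (coeff v (d - e ! j)) (e ! j)"]
      coeff_pscale algebra_simps)

lemma multilinear_Cons:
  assumes f: "multilinear_into (Suc R) V s f" and v: "v \<in> vecs V"
  shows "multilinear_into R V s (\<lambda>vs. f (v # vs))"
  unfolding multilinear_into_def
proof (intro conjI ballI allI impI)
  fix vs i x y c assume vs: "vs \<in> tuples R V" and i: "i < R" and x: "x \<in> vecs V"
  have vvs: "v # vs \<in> tuples (Suc R) V" using vs v by (auto simp: tuples_def)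
  have upd: "v # vs[i := z] = (v # vs)[Suc i := z]" for z by simp
  have i': "Suc i < Suc R" using i by simp
  show "f (v # vs[i := x + y]) = f (v # vs[i := x]) + f (v # vs[i := y])" if "y \<in> vecs V"
    unfolding upd using f vvs i' x that unfolding multilinear_into_def by blast
  show "f (v # vs[i := scl V c x]) = s c (f (v # vs[i := x]))"
    unfolding upd using f vvs i' x unfolding multilinear_into_def by blast
qed

text \<open>Induction on the number of arguments: expand the first one in monomials, then apply the
  hypothesis to the map with that monomial fixed. The target is arbitrary because the lemma is
  applied to the map that sends a tuple to its pure tensor.\<close>

lemma multilinear_expand:
  assumes "vector_space s"
  assumes "multilinear_into R (Sym_upper_E d) s f" "vs \<in> tuples R (Sym_upper_E d)"
  shows "f vs = (\<Sum>e\<in>exps R d. s (mono_coeff d e vs) (f (map (hmonom d) e)))"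
  using assms(2,3)
proof (induction R arbitrary: f vs)
  interpret vector_space s by fact
  case 0
  then show ?case by (simp add: exps_0 mono_coeff_def tuples_def)
next
  interpret vector_space s by fact
  case (Suc R)
  let ?V = "Sym_upper_E d :: ('a, 'a ^ 2 ^ 2, 'a poly poly) rep"
  let ?S = "vecs ?V"
  obtain v ws where vs: "vs = v # ws" and v: "v \<in> ?S" and ws: "ws \<in> tuples R ?V"
    using Suc.prems(2) by (auto simp: tuples_def length_Suc_conv)
  define g where "g x = f (x # ws)" for x
  \<comment> \<open>Multilinearity is stated through list updates, so a change of head is read as an
    update at position 0.\<close>
  have upd: "x # ws = vs[0 := x]" for x by (simp add: vs)
  have g_add: "g (x + y) = g x + g y" if "x \<in> ?S" "y \<in> ?S" for x y
    unfolding g_def upd using Suc.prems that unfolding multilinear_into_def by blast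
  have g_scale: "g (pscale c x) = s c (g x)" if "x \<in> ?S" for c x
    using Suc.prems that unfolding multilinear_into_def g_def upd scl_Sym_upper_E by blast
  have g_sum: "g (\<Sum>k\<in>A. h k) = (\<Sum>k\<in>A. g (h k))" if "finite A" "\<And>k. k \<in> A \<Longrightarrow> h k \<in> ?S" for A
      and h :: "nat \<Rightarrow> _"
    using that
  proof (induction A rule: finite_induct)
    case empty
    have "0 \<in> ?S" by (rule pscale.subspace_0[OF subspace_Sym_upper_E])
    then show ?case using g_scale[of 0 0] by simp
  next
    case (insert a A)
    then show ?case
      by (simp add: g_add pscale.subspace_sum[OF subspace_Sym_upper_E])
  qed
  have "f vs = g v" by (simp add: g_def vs)
  also have "\<dots> = g (\<Sum>k\<le>d. pscale (coeff (coeff v (d - k)) k) (hmonom d k))"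
    using Sym_upper_E_expand[OF v] by simp
  also have "\<dots> = (\<Sum>k\<le>d. g (pscale (coeff (coeff v (d - k)) k) (hmonom d k)))"
    by (intro g_sum pscale.subspace_scale[OF subspace_Sym_upper_E] hmonom_in) auto
  also have "\<dots> = (\<Sum>k\<le>d. s (coeff (coeff v (d - k)) k) (f (hmonom d k # ws)))"
    by (intro sum.cong refl) (subst g_scale, auto simp: hmonom_in g_def)
  also have "\<dots> = (\<Sum>k\<le>d. s (coeff (coeff v (d - k)) k)
      (\<Sum>e\<in>exps R d. s (mono_coeff d e ws) (f (hmonom d k # map (hmonom d) e))))"
    by (intro sum.cong arg_cong[where f = "s _"] Suc.IH multilinear_Cons[OF Suc.prems(1)])
      (use ws hmonom_in in auto)
  also have "\<dots> = (\<Sum>e\<in>exps (Suc R) d. s (mono_coeff d e vs) (f (map (hmonom d) e)))"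
    unfolding sum_exps_Suc scale_sum_right
    by (intro sum.cong refl) (use ws in \<open>auto simp: mono_coeff_def vs tuples_def
        prod.lessThan_Suc_shift simp del: prod.lessThan_Suc\<close>)
  finally show ?case .
qed

abbreviation pure_power :: "nat \<Rightarrow> ('a::field, 'g, 'v::ab_group_add) rep \<Rightarrow> 'v list \<Rightarrow>
    ('v list \<Rightarrow> 'a) \<Rightarrow> 'a" where
  "pure_power R V \<equiv> pure_tensor (multilinear_into R V (*))"

definition mono_tensor :: "nat \<Rightarrow> nat list \<Rightarrow> ('a::field poly poly list \<Rightarrow> 'a) \<Rightarrow> 'a" where
  "mono_tensor d e =
     pure_power (length e) (Sym_upper_E d :: ('a, 'a ^ 2 ^ 2, 'a poly poly) rep) (map (hmonom d) e)"

lemma hmonom_tuples: "e \<in> exps R d \<Longrightarrow> map (hmonom d) e \<in> tuples R (Sym_upper_E d)"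
  by (auto simp: exps_def tuples_def subset_iff intro!: hmonom_in)

lemma vecs_tensor_power: "vecs (tensor_power R V) = fscale.span (pure_power R V ` tuples R V)"
  by (simp add: tensor_power_def)

lemma mono_tensor_in: "e \<in> exps R d \<Longrightarrow> mono_tensor d e \<in> vecs (tensor_power R (Sym_upper_E d))"
  unfolding vecs_tensor_power mono_tensor_def
  by (auto dest: exps_length intro!: fscale.span_base imageI hmonom_tuples)

text \<open>A tensor is a functional on multilinear forms, so its coordinates are its values at the
  forms \<open>mono_coeff d e\<close>. Both sides are linear in \<open>t\<close>, which reduces the
  claim to pure tensors and \<open>multilinear_expand\<close>.\<close>

lemma tensor_power_expand:
  fixes t :: "('a::field poly poly list \<Rightarrow> 'a) \<Rightarrow> 'a"
  assumes "t \<in> vecs (tensor_power R (Sym_upper_E d))"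
  shows "t = (\<Sum>e\<in>exps R d. fscale (t (mono_coeff d e)) (mono_tensor d e))"
  using assms unfolding vecs_tensor_power
proof (induction rule: fscale.span_induct_alt)
  case base
  show ?case by simp
next
  case (step c x y)
  then obtain vs where vs: "vs \<in> tuples R (Sym_upper_E d)"
      and x: "x = pure_power R (Sym_upper_E d) vs"
    by auto
  have
      "x = (\<Sum>e\<in>exps R d. fscale (mono_coeff d e vs) (pure_power R (Sym_upper_E d) (map (hmonom d) e)))"
    unfolding x by (intro multilinear_expand vector_space_fscale multilinear_pure_tensor vs)
  also have "\<dots> = (\<Sum>e\<in>exps R d. fscale (x (mono_coeff d e)) (mono_tensor d e))"
  proof (intro sum.cong refl)
    fix e assume e: "e \<in> exps R d"
    have "x (mono_coeff d e) = mono_coeff d e vs"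
      using multilinear_mono_coeff[OF exps_length[OF e], of d, where 'a = 'a]
      by (simp add: x pure_tensor_def)
    then show "fscale (mono_coeff d e vs) (pure_power R (Sym_upper_E d) (map (hmonom d) e)) =
        fscale (x (mono_coeff d e)) (mono_tensor d e)"
      by (simp add: mono_tensor_def exps_length[OF e])
  qed
  finally have x': "x = \<dots>" .
  have "fscale c x + y = fscale c (\<Sum>e\<in>exps R d. fscale (x (mono_coeff d e)) (mono_tensor d e)) +
      (\<Sum>e\<in>exps R d. fscale (y (mono_coeff d e)) (mono_tensor d e))"
    by (rule arg_cong2[where f = "\<lambda>a b. fscale c a + b", OF x' step(2)])
  also have "\<dots> = (\<Sum>e\<in>exps R d. fscale ((fscale c x + y) (mono_coeff d e)) (mono_tensor d e))"
    unfolding fscale.scale_sum_right sum.distrib[symmetric]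
    by (intro sum.cong refl) (simp add: fscale_def fun_eq_iff algebra_simps)
  finally show ?case .
qed

section \<open>Permutation of tensor positions\<close>

lemma linear_push: "Vector_Spaces.linear fscale fscale (push \<B> \<psi> :: _ \<Rightarrow> ('x \<Rightarrow> 'a::field) \<Rightarrow> 'a)"
  unfolding Vector_Spaces.linear_iff
  by (auto simp: vector_space_fscale push_def fscale_def fun_eq_iff)

lemma permute_list_update:
  assumes "p permutes {..<length xs}" "i < length xs"
  shows "permute_list p (xs[i := x]) = (permute_list p xs)[inv p i := x]"
proof (rule nth_equalityI)
  fix j assume j: "j < length (permute_list p (xs[i := x]))"
  have pj: "p j < length xs" using j permutes_in_image[OF assms(1), of j] by simp
  have "p j = i \<longleftrightarrow> j = inv p i" using assms(1) by (metis permutes_inverses)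
  then show "permute_list p (xs[i := x]) ! j = (permute_list p xs)[inv p i := x] ! j"
    using assms j pj by (auto simp: permute_list_nth nth_list_update)
qed simp

lemma permute_tuples: "p permutes {..<R} \<Longrightarrow> vs \<in> tuples R V \<Longrightarrow> permute_list p vs \<in> tuples R V"
  by (auto simp: tuples_def)

text \<open>An update at \<open>i\<close> turns into an update at \<open>inv p i\<close>. This
  closure is the condition under which \<open>push\<close> sends pure tensors to pure
  tensors.\<close>

lemma multilinear_permute:
  assumes p: "p permutes {..<R}" and B: "multilinear_into R V s B"
  shows "multilinear_into R V s (B \<circ> permute_list p)"
  unfolding multilinear_into_def comp_def
proof (intro conjI ballI allI impI)
  fix vs i x y c assume vs: "vs \<in> tuples R V" and i: "i < R" and x: "x \<in> vecs V"
  have upd: "permute_list p (vs[i := z]) = (permute_list p vs)[inv p i := z]" for z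
    using p i vs by (intro permute_list_update) (auto simp: tuples_def)
  have vs': "permute_list p vs \<in> tuples R V" by (rule permute_tuples[OF p vs])
  have i': "inv p i < R" using permutes_in_image[OF permutes_inv[OF p], of i] i by simp
  show "B (permute_list p (vs[i := x + y])) =
      B (permute_list p (vs[i := x])) + B (permute_list p (vs[i := y]))"
    if "y \<in> vecs V"
    unfolding upd using B vs' i' x that unfolding multilinear_into_def by blast
  show "B (permute_list p (vs[i := scl V c x])) = s c (B (permute_list p (vs[i := x])))"
    unfolding upd using B vs' i' x unfolding multilinear_into_def by blast
qed

text \<open>Reindexing the product over positions by \<open>inv p\<close> moves the permutation from
  the exponents to the arguments. Symmetry of a tensor thereby becomes symmetry of its
  coordinates.\<close>

lemma mono_coeff_permute:
  assumes p: "p permutes {..<length e}"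
  shows "mono_coeff d (permute_list p e) = mono_coeff d e \<circ> permute_list (inv p)"
proof
  fix vs :: "'a poly poly list"
  show "mono_coeff d (permute_list p e) vs = (mono_coeff d e \<circ> permute_list (inv p)) vs"
  proof (cases "length vs = length e")
    case True
    have p': "inv p permutes {..<length e}" by (rule permutes_inv[OF p])
    have "(\<Prod>i<length e. coeff (coeff (vs ! i) (d - permute_list p e ! i)) (permute_list p e ! i))
      = (\<Prod>i<length e. coeff (coeff (vs ! i) (d - e ! p i)) (e ! p i))"
      using p by (intro prod.cong) (auto simp: permute_list_nth)
    also have "\<dots> =
        (\<Prod>i<length e. coeff (coeff (vs ! inv p i) (d - e ! p (inv p i))) (e ! p (inv p i)))"
      using prod.permute[OF p', of "\<lambda>i. coeff (coeff (vs ! i) (d - e ! p i)) (e ! p i)"]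
          by (simp add: comp_def)
    also have "\<dots> = (\<Prod>i<length e. coeff (coeff (permute_list (inv p) vs ! i) (d - e ! i)) (e ! i))"
      using p p' True by (intro prod.cong) (auto simp: permute_list_nth permutes_inverses)
    finally show ?thesis using True by (simp add: mono_coeff_def)
  qed (simp add: mono_coeff_def)
qed

text \<open>The orbits of the symmetric group on exponent lists are labelled by multisets of
  exponents; this is the orbit sum of monomial tensors, with each distinct rearrangement counted
  once.\<close>

definition mono_sym :: "nat \<Rightarrow> nat multiset \<Rightarrow> ('a::field poly poly list \<Rightarrow> 'a) \<Rightarrow> 'a" where
  "mono_sym d \<mu> = (\<Sum>e | mset e = \<mu>. mono_tensor d e)"

abbreviation exp_msets :: "nat \<Rightarrow> nat \<Rightarrow> nat multiset set" where
  "exp_msets R d \<equiv> multisets_of_size {..d} R"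

lemma mset_exps: "\<mu> \<in> exp_msets R d \<Longrightarrow> {e. mset e = \<mu>} \<subseteq> exps R d"
  by (auto simp: multisets_of_size_def exps_def)

lemma mset_in_exp_msets: "e \<in> exps R d \<Longrightarrow> mset e \<in> exp_msets R d"
  by (auto simp: multisets_of_size_def exps_def)

lemma finite_exp_msets: "finite (exp_msets R d)"
  by (rule finite_multisets_of_size) simp

lemma mono_tensor_permute:
  assumes p: "p permutes {..<R}" and e: "e \<in> exps R d"
  shows "push (multilinear_into R (Sym_upper_E d :: ('a::field, 'a ^ 2 ^ 2, 'a poly poly) rep)
      (*)) (permute_list p) (mono_tensor d e)
    = mono_tensor d (permute_list p e)"
  using e p unfolding mono_tensor_def exps_length[OF e]
  by (subst push_pure_tensor) (auto simp: exps_length multilinear_permute permute_list_map)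

lemma vecs_Sym_lower: "w \<in> vecs (Sym_lower R V) \<longleftrightarrow> w \<in> vecs (tensor_power R V) \<and>
   (\<forall>\<sigma>. \<sigma> permutes {..<R} \<longrightarrow> permute_tensor R V \<sigma> w = w)"
  by (simp add: Sym_lower_def)

text \<open>A permutation of positions only permutes the summands, since rearranging a list
  preserves its multiset.\<close>

lemma mono_sym_in:
  assumes \<mu>: "\<mu> \<in> exp_msets R d"
  shows "(mono_sym d \<mu> :: ('a::field poly poly list \<Rightarrow> 'a) \<Rightarrow> 'a)
      \<in> vecs (Sym_lower R (Sym_upper_E d))"
  unfolding vecs_Sym_lower
proof (intro conjI allI impI)
  show "mono_sym d \<mu> \<in> vecs (tensor_power R (Sym_upper_E d))"
    unfolding mono_sym_def using mset_exps[OF \<mu>] mono_tensor_in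
    by (auto simp: vecs_tensor_power intro!: fscale.span_sum)
next
  fix \<sigma> assume \<sigma>: "\<sigma> permutes {..<R}"
  then have \<sigma>': "inv \<sigma> permutes {..<R}" by (rule permutes_inv)
  let ?P = "permute_tensor R (Sym_upper_E d :: ('a, 'a ^ 2 ^ 2, 'a poly poly) rep) \<sigma>"
  have len: "length e = R" if "mset e = \<mu>" for e
    using that mset_exps[OF \<mu>] exps_length by blast
  interpret P: Vector_Spaces.linear fscale fscale ?P
    unfolding permute_tensor_def by (rule linear_push)
  have "?P (mono_sym d \<mu>) = (\<Sum>e | mset e = \<mu>. ?P (mono_tensor d e))"
    by (simp add: mono_sym_def P.sum)
  also have "\<dots> = (\<Sum>e | mset e = \<mu>. mono_tensor d (permute_list (inv \<sigma>) e))"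
    using mono_tensor_permute[OF \<sigma>'] mset_exps[OF \<mu>]
    by (intro sum.cong refl) (auto simp: permute_tensor_def)
  also have "\<dots> = (\<Sum>e | mset e = \<mu>. mono_tensor d e)"
  proof (rule sum.reindex_bij_witness[where i = "permute_list \<sigma>" and j = "permute_list (inv \<sigma>)"])
    fix e assume "e \<in> {e. mset e = \<mu>}"
    then have e: "mset e = \<mu>" and [simp]: "length e = R" using len by auto
    show "permute_list \<sigma> (permute_list (inv \<sigma>) e) = e" "permute_list (inv \<sigma>) (permute_list \<sigma> e) = e"
      using \<sigma> \<sigma>' by (simp_all add: permute_list_compose[symmetric] permutes_inv_o)
    show "permute_list \<sigma> e \<in> {e. mset e = \<mu>}" "permute_list (inv \<sigma>) e \<in> {e. mset e = \<mu>}"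
      using \<sigma> \<sigma>' e by simp_all
  qed simp
  finally show "?P (mono_sym d \<mu>) = mono_sym d \<mu>" by (simp add: mono_sym_def)
qed

text \<open>The coordinates of a symmetric tensor are constant on orbits of exponent lists, so its
  monomial expansion groups into orbit sums. Nothing is divided by a group order, so the
  characteristic is arbitrary.\<close>

lemma Sym_lower_span:
  fixes t :: "('a::field poly poly list \<Rightarrow> 'a) \<Rightarrow> 'a"
  assumes t: "t \<in> vecs (Sym_lower R (Sym_upper_E d))"
  shows "t \<in> fscale.span (mono_sym d ` exp_msets R d)"
proof -
  let ?V = "Sym_upper_E d :: ('a, 'a ^ 2 ^ 2, 'a poly poly) rep"
  have inv: "t (mono_coeff d e) = t (mono_coeff d e')"
    if e: "e \<in> exps R d" "e' \<in> exps R d" "mset e = mset e'" for e e'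
  proof -
    obtain p where p: "p permutes {..<R}" "permute_list p e' = e"
      using mset_eq_permutation[OF e(3)] exps_length[OF e(2)] by metis
    have "t (mono_coeff d e') = permute_tensor R ?V p t (mono_coeff d e')"
      using t p(1) by (simp add: vecs_Sym_lower)
    also have "\<dots> = t (mono_coeff d e' \<circ> permute_list (inv p))"
      using multilinear_mono_coeff[OF exps_length[OF e(2)], of d, where 'a = 'a]
      by (simp add: permute_tensor_def push_def)
    also have "mono_coeff d e' \<circ> permute_list (inv p) = (mono_coeff d e :: 'a poly poly list \<Rightarrow> 'a)"
      using mono_coeff_permute[of p e' d, where 'a = 'a] p exps_length[OF e(2)] by simp
    finally show ?thesis by simp
  qed
  \<comment> \<open>The common coordinate on the orbit \<open>\<mu>\<close>, read off at a chosen
    list; by \<open>inv\<close> the choice does not matter.\<close>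
  define k where "k \<mu> = t (mono_coeff d (SOME e. mset e = \<mu>))" for \<mu>
  have k: "t (mono_coeff d e) = k (mset e)" if "e \<in> exps R d" for e
  proof -
    have "mset (SOME e'. mset e' = mset e) = mset e" by (rule someI[of _ e]) simp
    then show ?thesis using that unfolding k_def
      by (intro inv) (auto intro: subsetD[OF mset_exps[OF mset_in_exp_msets[OF that]]])
  qed
  have "t = (\<Sum>e\<in>exps R d. fscale (k (mset e)) (mono_tensor d e))"
    using tensor_power_expand[of t R d] t by (simp add: vecs_Sym_lower flip: k)
  also have "\<dots> = (\<Sum>\<mu>\<in>exp_msets R d. \<Sum>e | e \<in> exps R d \<and>
      mset e = \<mu>. fscale (k (mset e)) (mono_tensor d e))"
    by (rule sum.group[symmetric]) (auto simp: finite_exp_msets mset_in_exp_msets)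
  also have "\<dots> = (\<Sum>\<mu>\<in>exp_msets R d. fscale (k \<mu>) (mono_sym d \<mu>))"
    unfolding mono_sym_def fscale.scale_sum_right
    using mset_exps by (intro sum.cong refl) (auto simp: subset_iff)
  finally show ?thesis
    by (metis (no_types, lifting) fscale.span_base fscale.span_scale fscale.span_sum imageI)
qed

section \<open>Tensors as functions of points\<close>

text \<open>An action is meaningful only on \<open>vecs V\<close>, so linearity and stability are
  asked for there alone. This is what makes precomposition with \<open>map \<psi>\<close> preserve
  multilinear forms.\<close>

definition linear_end :: "('a::field, 'g, 'v::ab_group_add) rep \<Rightarrow> ('v \<Rightarrow> 'v) \<Rightarrow> bool" where
  "linear_end V \<psi> \<longleftrightarrow> (\<forall>x\<in>vecs V. \<psi> x \<in> vecs V) \<and>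
     (\<forall>x\<in>vecs V. \<forall>y\<in>vecs V. \<psi> (x + y) = \<psi> x + \<psi> y) \<and> (\<forall>c. \<forall>x\<in>vecs V. \<psi> (scl V c x) = scl V c (\<psi> x))"

lemma multilinear_map:
  assumes \<psi>: "linear_end V \<psi>" and B: "multilinear_into R V s B"
  shows "multilinear_into R V s (B \<circ> map \<psi>)"
  unfolding multilinear_into_def comp_def map_update
proof (intro conjI ballI allI impI)
  fix vs i x y c assume vs: "vs \<in> tuples R V" and i: "i < R" and x: "x \<in> vecs V"
  have vs': "map \<psi> vs \<in> tuples R V" using vs \<psi> by (auto simp: tuples_def linear_end_def)
  have x': "\<psi> x \<in> vecs V" using x \<psi> by (simp add: linear_end_def)
  have sc: "\<psi> (scl V c x) = scl V c (\<psi> x)" using x \<psi> by (simp add: linear_end_def)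
  show "B ((map \<psi> vs)[i := \<psi> (x + y)]) = B ((map \<psi> vs)[i := \<psi> x]) + B ((map \<psi> vs)[i := \<psi> y])"
    if "y \<in> vecs V"
  proof -
    have "\<psi> y \<in> vecs V" "\<psi> (x + y) = \<psi> x + \<psi> y" using x that \<psi> by (simp_all add: linear_end_def)
    then show ?thesis using B vs' i x' unfolding multilinear_into_def by simp
  qed
  show "B ((map \<psi> vs)[i := \<psi> (scl V c x)]) = s c (B ((map \<psi> vs)[i := \<psi> x]))"
    unfolding sc using B vs' i x' unfolding multilinear_into_def by blast
qed

lemma push_pure_power:
  "linear_end V \<psi> \<Longrightarrow> push (multilinear_into R V (*)) (map \<psi>) (pure_power R V vs) =
      pure_power R V (map \<psi> vs)"
  by (intro push_pure_tensor multilinear_map)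

lemma linear_image_span:
  assumes "Vector_Spaces.linear s s' f" "module.span s S = A" "f ` S \<subseteq> module.span s' T" "x \<in> A"
  shows "f x \<in> module.span s' T"
proof -
  interpret f: Vector_Spaces.linear s s' f by fact
  have "f ` A \<subseteq> module.span s' T"
    unfolding assms(2)[symmetric] f.span_image[symmetric]
    using assms(3) f.vs2.span_minimal f.vs2.subspace_span by blast
  then show ?thesis using assms(4) by blast
qed

lemma push_tensor_power:
  assumes \<psi>: "linear_end V \<psi>" and t: "t \<in> vecs (tensor_power R V)"
  shows "push (multilinear_into R V (*)) (map \<psi>) t \<in> vecs (tensor_power R V)"
proof -
  have "map \<psi> vs \<in> tuples R V" if "vs \<in> tuples R V" for vs
    using that \<psi> by (auto simp: tuples_def linear_end_def)
  then show ?thesis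
    unfolding vecs_tensor_power
    by (intro linear_image_span[OF linear_push vecs_tensor_power[symmetric] _ t])
      (auto simp: push_pure_power[OF \<psi>] intro: fscale.span_base)
qed

lemma linear_eq_on:
  assumes "Vector_Spaces.linear s s' f" "Vector_Spaces.linear s s' g" "x \<in> module.span s S"
    "\<And>b. b \<in> S \<Longrightarrow> f b = g b"
  shows "f x = g x"
proof -
  interpret f: Vector_Spaces.linear s s' f by fact
  interpret vector_space_pair s s' ..
  show ?thesis by (rule linear_eq_on[OF assms])
qed

text \<open>One map rearranges positions and the other acts on each entry, so they commute on pure
  tensors, hence on their span. The symmetric tensors are therefore stable under the group.\<close>

lemma push_permute_tensor:
  assumes \<psi>: "linear_end V \<psi>" and p: "p permutes {..<R}" and t: "t \<in> vecs (tensor_power R V)"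
  shows "permute_tensor R V p (push (multilinear_into R V (*)) (map \<psi>) t) =
    push (multilinear_into R V (*)) (map \<psi>) (permute_tensor R V p t)"
proof -
  let ?P = "push (multilinear_into R V (*))"
  have p': "inv p permutes {..<R}" by (rule permutes_inv[OF p])
  have P: "?P (permute_list (inv p)) (pure_power R V vs) =
      pure_power R V (permute_list (inv p) vs)" for vs
    by (intro push_pure_tensor multilinear_permute[OF p'])
  have "(?P (permute_list (inv p)) \<circ> ?P (map \<psi>)) t = (?P (map \<psi>) \<circ> ?P (permute_list (inv p))) t"
  proof (rule linear_eq_on[where s' = fscale, OF _ _ t[unfolded vecs_tensor_power]])
    fix b assume "b \<in> pure_power R V ` tuples R V"
    then obtain vs where vs: "vs \<in> tuples R V" and b: "b = pure_power R V vs" by auto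
    have "inv p permutes {..<length vs}" using vs p' by (simp add: tuples_def)
    then show "(?P (permute_list (inv p)) \<circ> ?P (map \<psi>)) b =
        (?P (map \<psi>) \<circ> ?P (permute_list (inv p))) b"
      by (simp add: b P push_pure_power[OF \<psi>] permute_list_map)
  qed (intro Vector_Spaces.linear_compose[OF linear_push linear_push])+
  then show ?thesis by (simp add: permute_tensor_def)
qed

lemma push_Sym_lower:
  assumes \<psi>: "linear_end V \<psi>" and t: "t \<in> vecs (Sym_lower R V)"
  shows "push (multilinear_into R V (*)) (map \<psi>) t \<in> vecs (Sym_lower R V)"
  using t push_tensor_power[OF \<psi>] push_permute_tensor[OF \<psi>] by (simp add: vecs_Sym_lower)

lemma scl_Sym_lower [simp]: "scl (Sym_lower R V) = fscale"
  by (simp add: Sym_lower_def tensor_power_def)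

lemma act_Sym_lower: "act (Sym_lower R V) g = push (multilinear_into R V (*)) (map (act V g))"
  by (simp add: Sym_lower_def tensor_power_def)

lemma linear_end_Sym_upper_E: "linear_end (Sym_upper_E d) (act (Sym_upper_E d) g)"
  by (simp add: linear_end_def act_in_Sym_upper_E)
      (simp add: act_Sym_upper_E subst_XY_add subst_XY_pscale)

lemma linear_end_Sym_lower:
  assumes "linear_end V (act V g)" shows "linear_end (Sym_lower R V) (act (Sym_lower R V) g)"
proof -
  interpret Vector_Spaces.linear fscale fscale "push (multilinear_into R V (*)) (map (act V g)) ::
      _ \<Rightarrow> _ \<Rightarrow> 'a"
    by (rule linear_push)
  show ?thesis
    using push_Sym_lower[OF assms] by (simp add: linear_end_def act_Sym_lower add scale)
qed

section \<open>Evaluation of tensors at lists of points\<close>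

definition gscale :: "'a::field \<Rightarrow> ('x \<Rightarrow> 'a poly poly) \<Rightarrow> 'x \<Rightarrow> 'a poly poly" where
  "gscale c F = (\<lambda>p. pscale c (F p))"

lemma vector_space_gscale: "vector_space (gscale :: 'a::field \<Rightarrow> ('x \<Rightarrow> _) \<Rightarrow> _)"
  by unfold_locales
    (auto simp: gscale_def fun_eq_iff pscale.scale_right_distrib pscale.scale_left_distrib)

interpretation gscale: vector_space "gscale :: 'a::field \<Rightarrow> ('x \<Rightarrow> 'a poly poly) \<Rightarrow> _"
  by (rule vector_space_gscale)

type_synonym 'a point = "'a poly poly \<times> 'a poly poly"

definition eval_at :: "'a::field poly poly \<Rightarrow> 'a point \<Rightarrow> 'a poly poly" where
  "eval_at P p = subst_XY P (fst p) (snd p)"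

text \<open>A pure tensor read as a product of forms, one per point. The value 0 at lists of the
  wrong length makes it a function on all lists of points.\<close>

definition eval_prod :: "nat \<Rightarrow> 'a::field poly poly list \<Rightarrow> 'a point list \<Rightarrow> 'a poly poly" where
  "eval_prod R vs p = (if length p = R then \<Prod>i<R. eval_at (vs ! i) (p ! i) else 0)"

lemma eval_at_add: "eval_at (P + Q) p = eval_at P p + eval_at Q p"
  and eval_at_pscale: "eval_at (pscale c P) p = pscale c (eval_at P p)"
  by (simp_all add: eval_at_def subst_XY_add subst_XY_pscale)

lemma multilinear_eval_prod: "multilinear_into R (Sym_upper_E d) gscale (eval_prod R)"
proof -
  have upd: "eval_prod R (vs[i := x]) p =
      (if length p = R then eval_at x (p ! i) * (\<Prod>j\<in>{..<R} - {i}. eval_at (vs ! j) (p ! j)) else 0)"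
    if "vs \<in> tuples R (Sym_upper_E d)" "i < R" for vs i x p
    using prod_list_update[where h = "\<lambda>j v. eval_at v (p ! j)", OF that(2)] that(1)
    by (simp add: eval_prod_def tuples_def)
  show ?thesis
    unfolding multilinear_into_def fun_eq_iff gscale_def
    by (simp add: upd eval_at_add eval_at_pscale pscale_mult_left distrib_right)
qed

text \<open>The linear map supplied by \<open>tensor_power_universal\<close>; its values are
  determined on the span of the pure tensors only.\<close>

definition Ev :: "nat \<Rightarrow> nat \<Rightarrow> (('a::field poly poly list \<Rightarrow> 'a) \<Rightarrow> 'a) \<Rightarrow> 'a point list \<Rightarrow>
    'a poly poly" where
  "Ev R d = (SOME L. Vector_Spaces.linear fscale gscale L \<and>
     (\<forall>vs\<in>tuples R (Sym_upper_E d). L (pure_power R (Sym_upper_E d) vs) = eval_prod R vs))"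

lemma
  shows linear_Ev: "Vector_Spaces.linear fscale gscale (Ev R d)"
    and Ev_pure: "vs \<in> tuples R (Sym_upper_E d) \<Longrightarrow> Ev R d (pure_power R (Sym_upper_E d) vs) =
        eval_prod R vs"
  using someI_ex[OF tensor_power_universal[OF vector_space_gscale multilinear_eval_prod, of R d]]
  unfolding Ev_def by auto

definition act_point :: "'a::field ^ 2 ^ 2 \<Rightarrow> 'a point \<Rightarrow> 'a point" where
  "act_point g p = (eval_at (lin_X g) p, eval_at (lin_Y g) p)"

text \<open>Associativity of substitution: acting on the form amounts to moving the point. All
  equivariance below comes from this.\<close>

lemma eval_at_act: "eval_at (act (Sym_upper_E d) g P) p = eval_at P (act_point g p)"
  by (simp add: eval_at_def act_point_def act_Sym_upper_E subst_XY_subst_XY)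

lemma linear_gscale_comp:
  assumes "Vector_Spaces.linear fscale gscale L"
  shows "Vector_Spaces.linear fscale gscale (\<lambda>t p. L t (h p))"
  using assms unfolding Vector_Spaces.linear_iff
  by (simp add: vector_space_gscale) (simp add: gscale_def fun_eq_iff)

lemma Ev_act:
  fixes t :: "('a::field poly poly list \<Rightarrow> 'a) \<Rightarrow> 'a"
  assumes t: "t \<in> vecs (Sym_lower R (Sym_upper_E d))"
  shows "Ev R d (act (Sym_lower R (Sym_upper_E d)) g t) p = Ev R d t (map (act_point g) p)"
proof -
  let ?A = "act (Sym_lower R (Sym_upper_E d)) g"
  have "(Ev R d \<circ> ?A) t = (\<lambda>p. Ev R d t (map (act_point g) p))"
  proof (rule linear_eq_on[where s = fscale and s' = gscale
      and g = "\<lambda>t p. Ev R d t (map (act_point g) p)"])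
    show "t \<in> fscale.span (pure_power R (Sym_upper_E d) ` tuples R (Sym_upper_E d))"
      using t by (simp add: vecs_Sym_lower vecs_tensor_power)
    fix b :: "('a poly poly list \<Rightarrow> 'a) \<Rightarrow> 'a"
    assume "b \<in> pure_power R (Sym_upper_E d) ` tuples R (Sym_upper_E d)"
    then obtain vs where vs: "vs \<in> tuples R (Sym_upper_E d)"
        and b: "b = pure_power R (Sym_upper_E d) vs"
      by auto
    have vs': "map (act (Sym_upper_E d) g) vs \<in> tuples R (Sym_upper_E d)"
      using vs by (auto simp: tuples_def act_in_Sym_upper_E)
    have "(Ev R d \<circ> ?A) b = eval_prod R (map (act (Sym_upper_E d) g) vs)"
      by (simp add: b act_Sym_lower push_pure_power linear_end_Sym_upper_E Ev_pure[OF vs'])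
    also have "\<dots> = (\<lambda>p. Ev R d b (map (act_point g) p))"
      using vs by (auto simp: b Ev_pure[OF vs] eval_prod_def fun_eq_iff eval_at_act tuples_def)
    finally show "(Ev R d \<circ> ?A) b = (\<lambda>p. Ev R d b (map (act_point g) p))" .
  next
    show "Vector_Spaces.linear fscale gscale (Ev R d \<circ> ?A)"
      unfolding act_Sym_lower by (rule Vector_Spaces.linear_compose[OF linear_push linear_Ev])
    show "Vector_Spaces.linear fscale gscale (\<lambda>t p. Ev R d t (map (act_point g) p))"
      by (rule linear_gscale_comp[OF linear_Ev])
  qed
  then show ?thesis by (simp add: fun_eq_iff)
qed

section \<open>Monomial symmetric functions of points\<close>

definition hpower :: "nat \<Rightarrow> 'a::field point list \<Rightarrow> nat list \<Rightarrow> 'a poly poly" where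
  "hpower d p e = (\<Prod>i<length e. fst (p ! i) ^ (e ! i) * snd (p ! i) ^ (d - e ! i))"

text \<open>The monomial symmetric polynomial of \<open>\<mu>\<close>, homogenized to degree
  \<open>d\<close> in each point; by \<open>Ev_mono_sym\<close> it is the function given by the
  orbit sum \<open>mono_sym d \<mu>\<close>.\<close>

definition hsym :: "nat \<Rightarrow> nat multiset \<Rightarrow> 'a::field point list \<Rightarrow> 'a poly poly" where
  "hsym d \<mu> p = (\<Sum>e | mset e = \<mu>. hpower d p e)"

lemma Ev_mono_sym:
  assumes \<mu>: "\<mu> \<in> exp_msets R d"
  shows "Ev R d (mono_sym d \<mu>) p = (if length p = R then hsym d \<mu> p else 0)"
proof -
  interpret Vector_Spaces.linear fscale gscale "Ev R d :: _ \<Rightarrow> 'a point list \<Rightarrow> _" by (rule linear_Ev)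
  have ap: "(\<Sum>a\<in>A. F a) x = (\<Sum>a\<in>A. F a x)" for F :: "nat list \<Rightarrow> 'a point list \<Rightarrow> 'a poly poly"
      and A x
    by (induction A rule: infinite_finite_induct) auto
  have "Ev R d (mono_tensor d e) p = (if length p = R then hpower d p e else 0)"
      if "mset e = \<mu>" for e
  proof -
    have e: "e \<in> exps R d" using mset_exps[OF \<mu>] that by auto
    show ?thesis
      unfolding mono_tensor_def exps_length[OF e] Ev_pure[OF hmonom_tuples[OF e]]
      by (auto simp: eval_prod_def exps_length[OF e] hpower_def eval_at_def hmonom_def
          subst_XY_mult subst_XY_power intro!: prod.cong)
  qed
  then show ?thesis by (simp add: mono_sym_def sum ap hsym_def)
qed

lemma hpower_permute:
  assumes "\<sigma> permutes {..<R}" "length p = R" "length e = R"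
  shows "hpower d (permute_list \<sigma> p) (permute_list \<sigma> e) = hpower d p e"
  using assms prod.permute[OF assms(1), of "\<lambda>i. fst (p ! i) ^ (e ! i) * snd (p ! i) ^ (d - e ! i)"]
  by (simp add: hpower_def permute_list_nth comp_def)

text \<open>Rearranging the points is undone by rearranging the exponent lists, over all of which
  the sum runs.\<close>

lemma hsym_permute:
  assumes "mset p = mset q" "size \<mu> = length p"
  shows "hsym d \<mu> p = hsym d \<mu> q"
proof -
  obtain \<sigma> where \<sigma>: "\<sigma> permutes {..<length q}" "permute_list \<sigma> q = p"
    using mset_eq_permutation[OF assms(1)] by blast
  have \<sigma>': "inv \<sigma> permutes {..<length q}" by (rule permutes_inv[OF \<sigma>(1)])
  show ?thesis
    unfolding hsym_def
  proof (rule sum.reindex_bij_witness[where i = "permute_list \<sigma>" and j = "permute_list (inv \<sigma>)"])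
    fix e assume "e \<in> {e. mset e = \<mu>}"
    then have e: "mset e = \<mu>" and [simp]: "length e = length q"
      using assms mset_eq_length[OF assms(1)] by auto
    show "permute_list \<sigma> (permute_list (inv \<sigma>) e) = e" "permute_list (inv \<sigma>) (permute_list \<sigma> e) = e"
      using \<sigma> \<sigma>' by (simp_all add: permute_list_compose[symmetric] permutes_inv_o)
    then show "hpower d q (permute_list (inv \<sigma>) e) = hpower d p e"
      using hpower_permute[OF \<sigma>(1), of q "permute_list (inv \<sigma>) e" d] \<sigma>(2) by simp
    show "permute_list \<sigma> e \<in> {e. mset e = \<mu>}" "permute_list (inv \<sigma>) e \<in> {e. mset e = \<mu>}"
      using \<sigma> \<sigma>' e by simp_all
  qed
qed

text \<open>Induction on the number of variables. Once the first variable is set to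
  \<open>x\<close>, the others range over distinct members of \<open>S - {x}\<close>, which is still
  large enough; this leaves polynomials in \<open>x\<close> of degree at most \<open>N\<close> with
  more than \<open>N\<close> roots.\<close>

lemma vanish_on_distinct:
  fixes k :: "nat list \<Rightarrow> 'k::idom"
  assumes "finite S" "M + N \<le> card S"
    and "\<And>xs. length xs = M \<Longrightarrow> distinct xs \<Longrightarrow> set xs \<subseteq> S \<Longrightarrow>
      (\<Sum>e\<in>exps M N. k e * (\<Prod>i<M. xs ! i ^ (e ! i))) = 0"
    and "e \<in> exps M N"
  shows "k e = 0"
  using assms
proof (induction M arbitrary: k S e)
  case 0
  then show ?case by (simp add: exps_0)
next
  case (Suc M)
  obtain j e' where e: "e = j # e'" and j: "j \<le> N" and e': "e' \<in> exps M N"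
    using Suc.prems(4) by (auto simp: exps_def length_Suc_conv)
  \<comment> \<open>For fixed \<open>x\<close>, the inner sum is the coefficient of the monomial
    \<open>e'\<close> in the remaining variables, so the hypothesis applies to it.\<close>
  have *: "(\<Sum>j\<le>N. k (j # e') * x ^ j) = 0" if x: "x \<in> S" for x
  proof (rule Suc.IH[of "S - {x}" "\<lambda>e. \<Sum>j\<le>N. k (j # e) * x ^ j"])
    show "finite (S - {x})" "M + N \<le> card (S - {x})" using Suc.prems x by auto
    fix xs assume "length xs = M" "distinct xs" "set xs \<subseteq> S - {x}"
    then have "(\<Sum>e\<in>exps (Suc M) N. k e * (\<Prod>i<Suc M. (x # xs) ! i ^ (e ! i))) = 0"
      using x by (intro Suc.prems(3)) auto
    then show "(\<Sum>e\<in>exps M N. (\<Sum>j\<le>N. k (j # e) * x ^ j) * (\<Prod>i<M. xs ! i ^ (e ! i))) = 0"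
      unfolding sum_exps_Suc prod.lessThan_Suc_shift sum.swap[of _ "exps M N"]
      by (simp add: sum_distrib_right mult.assoc)
  qed (rule e')
  \<comment> \<open>The same coefficient as a polynomial in the first variable: it vanishes on all
    of \<open>S\<close>, which has at least \<open>Suc M + N\<close> elements.\<close>
  define p where "p = (\<Sum>j\<le>N. monom (k (j # e')) j)"
  have "p = 0"
  proof (rule ccontr)
    assume p: "p \<noteq> 0"
    have "S \<subseteq> {x. poly p x = 0}" unfolding p_def poly_sum poly_monom using * by blast
    then have "card S \<le> degree p"
      by (intro order_trans[OF card_mono[OF poly_roots_finite[OF p]] card_poly_roots_bound[OF p]])
    moreover have "degree p \<le> N"
      unfolding p_def by (intro degree_sum_le order_trans[OF degree_monom_le]) auto
    ultimately show False using Suc.prems(2) by simp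
  qed
  moreover have "coeff p j = k e"
    using j by (simp add: p_def coeff_sum e if_distrib cong: if_cong)
  ultimately show ?case by simp
qed

section \<open>Linear independence of the products\<close>

lemma subspace_Sym_lower: "fscale.subspace (vecs (Sym_lower R V))"
proof -
  interpret P: Vector_Spaces.linear fscale fscale "permute_tensor R V p :: _ \<Rightarrow> _ \<Rightarrow> 'a" for p
    unfolding permute_tensor_def by (rule linear_push)
  show ?thesis
    by (rule fscale.subspaceI)
      (auto simp: vecs_Sym_lower vecs_tensor_power P.add P.scale P.zero fscale.span_zero
        intro: fscale.span_add fscale.span_scale)
qed

lemma Sym_lower_eq_span: "vecs (Sym_lower R (Sym_upper_E d)) =
    fscale.span (mono_sym d ` exp_msets R d)"
  using Sym_lower_span by (intro antisym fscale.span_minimal subspace_Sym_lower subsetI)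
      (auto intro: mono_sym_in)

section \<open>Tensor products of two representations\<close>

abbreviation pure2 :: "('a::field, 'g, 'v::ab_group_add) rep \<Rightarrow> ('a, 'g, 'w::ab_group_add) rep \<Rightarrow>
    'v \<times> 'w \<Rightarrow> ('v \<times> 'w \<Rightarrow> 'a) \<Rightarrow> 'a" where
  "pure2 V W \<equiv> pure_tensor (bilinear_into V W (*))"

lemma vecs_tensor: "vecs (V \<otimes> W) = fscale.span (pure2 V W ` (vecs V \<times> vecs W))"
  by (simp add: tensor_def)

lemma scl_tensor [simp]: "scl (V \<otimes> W) = fscale"
  by (simp add: tensor_def)

lemma act_tensor: "act (V \<otimes> W) g = push (bilinear_into V W (*)) (map_prod (act V g) (act W g))"
  by (simp add: tensor_def)

lemma pure2_add_left: "x \<in> vecs V \<Longrightarrow> x' \<in> vecs V \<Longrightarrow> y \<in> vecs W \<Longrightarrow> pure2 V W (x + x', y) =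
    pure2 V W (x, y) + pure2 V W (x', y)"
  and pure2_add_right: "x \<in> vecs V \<Longrightarrow> y \<in> vecs W \<Longrightarrow> y' \<in> vecs W \<Longrightarrow> pure2 V W (x, y + y') =
      pure2 V W (x, y) + pure2 V W (x, y')"
  and pure2_scale_left: "x \<in> vecs V \<Longrightarrow> y \<in> vecs W \<Longrightarrow> pure2 V W (scl V c x, y) =
      fscale c (pure2 V W (x, y))"
  and pure2_scale_right: "x \<in> vecs V \<Longrightarrow> y \<in> vecs W \<Longrightarrow> pure2 V W (x, scl W c y) =
      fscale c (pure2 V W (x, y))"
  using bilinear_pure_tensor[of V W] unfolding bilinear_into_def[of V W fscale] by blast+

text \<open>Two span inductions in turn: first the right factor varies while the left one is a
  generator, then the left factor varies.\<close>

lemma tensor_eq_span: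
  fixes V :: "('a::field, 'g, 'v::ab_group_add) rep" and W :: "('a, 'g, 'w::ab_group_add) rep"
  assumes V: "vector_space (scl V)" "vecs V = module.span (scl V) B"
    and W: "vector_space (scl W)" "vecs W = module.span (scl W) C"
  shows "vecs (V \<otimes> W) = fscale.span (pure2 V W ` (B \<times> C))"
proof (rule antisym)
  interpret V: vector_space "scl V" by fact
  interpret W: vector_space "scl W" by fact
  let ?T = "fscale.span (pure2 V W ` (B \<times> C))"
  have Vs: "V.subspace (vecs V)" and Ws: "W.subspace (vecs W)"
    by (simp_all add: V(2) W(2))
  have BV: "B \<subseteq> vecs V" and CW: "C \<subseteq> vecs W"
      by (simp_all add: V(2) W(2) V.span_superset W.span_superset)
  \<comment> \<open>Bilinearity is known only on \<open>vecs W\<close>, so membership of the partial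
    sums is carried through the induction.\<close>
  have 1: "w \<in> vecs W \<and> pure2 V W (b, w) \<in> ?T" if "w \<in> vecs W" "b \<in> B" for w b
    using that(1)[unfolded W(2)]
  proof (induction rule: W.span_induct_alt)
    case base
    have "pure2 V W (b, scl W 0 0) = fscale 0 (pure2 V W (b, 0))"
      using pure2_scale_right[of b V 0 W 0] BV that(2) W.subspace_0[OF Ws] by auto
    then have "pure2 V W (b, 0) = 0" by simp
    then show ?case by (simp only: fscale.span_zero W.subspace_0[OF Ws])
  next
    case (step c x y)
    then have x: "x \<in> vecs W" "scl W c x \<in> vecs W" using CW W.subspace_scale[OF Ws] by auto
    have "pure2 V W (b, scl W c x + y) = fscale c (pure2 V W (b, x)) + pure2 V W (b, y)"
      using pure2_add_right[of b V "scl W c x" W y] pure2_scale_right[of b V x W c] BV that(2) x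
          step(2)
      by auto
    also have "\<dots> \<in> ?T"
      using step that(2) by (intro fscale.span_add fscale.span_scale) (auto intro: fscale.span_base)
    finally show ?case using W.subspace_add[OF Ws] x step by auto
  qed
  have 2: "v \<in> vecs V \<and> pure2 V W (v, w) \<in> ?T" if "w \<in> vecs W" "v \<in> vecs V" for w v
    using that(2)[unfolded V(2)]
  proof (induction rule: V.span_induct_alt)
    case base
    have "pure2 V W (scl V 0 0, w) = fscale 0 (pure2 V W (0, w))"
      using pure2_scale_left[of 0 V w W 0] that(1) V.subspace_0[OF Vs] by auto
    then have "pure2 V W (0, w) = 0" by simp
    then show ?case by (simp only: fscale.span_zero V.subspace_0[OF Vs])
  next
    case (step c x y)
    then have x: "x \<in> vecs V" "scl V c x \<in> vecs V" using BV V.subspace_scale[OF Vs] by auto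
    have "pure2 V W (scl V c x + y, w) = fscale c (pure2 V W (x, w)) + pure2 V W (y, w)"
      using pure2_add_left[of "scl V c x" V y w W] pure2_scale_left[of x V w W c] that(1) x step(2)
      by auto
    also have "\<dots> \<in> ?T"
      using step 1[OF that(1)] by (intro fscale.span_add fscale.span_scale) auto
    finally show ?case using V.subspace_add[OF Vs] x step by auto
  qed
  show "vecs (V \<otimes> W) \<subseteq> ?T"
    unfolding vecs_tensor using 2 by (intro fscale.span_minimal fscale.subspace_span) auto
  show "?T \<subseteq> vecs (V \<otimes> W)"
    unfolding vecs_tensor using BV CW by (intro fscale.span_mono) auto
qed

lemma push_pure2:
  assumes "linear_end V \<psi>" "linear_end W \<theta>"
  shows "push (bilinear_into V W (*)) (map_prod \<psi> \<theta>) (pure2 V W x) = pure2 V W (map_prod \<psi> \<theta> x)"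
  using assms by (intro push_pure_tensor) (auto simp: bilinear_into_def linear_end_def)

lemma act_tensor_in:
  assumes "linear_end V (act V g)" "linear_end W (act W g)" "x \<in> vecs (V \<otimes> W)"
  shows "act (V \<otimes> W) g x \<in> vecs (V \<otimes> W)"
  unfolding vecs_tensor act_tensor
proof (intro linear_image_span[OF linear_push vecs_tensor[symmetric] _ assms(3)] image_subsetI)
  fix b assume "b \<in> pure2 V W ` (vecs V \<times> vecs W)"
  then show "push (bilinear_into V W (*)) (map_prod (act V g) (act W g)) b
      \<in> fscale.span (pure2 V W ` (vecs V \<times> vecs W))"
    using assms(1,2) push_pure2[OF assms(1,2)]
    by (force simp: linear_end_def intro!: fscale.span_base)
qed

abbreviation SymSym :: "nat \<Rightarrow> nat \<Rightarrow> ('a::field, 'a ^ 2 ^ 2, ('a poly poly list \<Rightarrow> 'a) \<Rightarrow> 'a) rep"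
    where
  "SymSym R d \<equiv> Sym_lower R (Sym_upper_E d)"

lemma linear_end_SymSym: "linear_end (SymSym R d) (act (SymSym R d) g)"
  by (intro linear_end_Sym_lower linear_end_Sym_upper_E)

text \<open>The product of the two values is bilinear, so it factors through the tensor product.
  Since \<open>h\<close> and \<open>k\<close> commute with \<open>map\<close>, moving all points of
  \<open>p\<close> moves the arguments of both factors, which gives the rule for the action.\<close>

lemma tensor_realization:
  fixes h k :: "'a::field point list \<Rightarrow> 'a point list"
  assumes h: "\<And>f p. h (map f p) = map f (h p)" and k: "\<And>f p. k (map f p) = map f (k p)"
  obtains L where "Vector_Spaces.linear fscale gscale L"
    "\<And>t u p. t \<in> vecs (SymSym a \<alpha>) \<Longrightarrow> u \<in> vecs (SymSym b \<beta>) \<Longrightarrow>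
       L (pure2 (SymSym a \<alpha>) (SymSym b \<beta>) (t, u)) p = Ev a \<alpha> t (h p) * Ev b \<beta> u (k p)"
    "\<And>x g p. x \<in> vecs (SymSym a \<alpha> \<otimes> SymSym b \<beta>) \<Longrightarrow>
       L (act (SymSym a \<alpha> \<otimes> SymSym b \<beta>) g x) p = L x (map (act_point g) p)"
proof -
  let ?V = "SymSym a \<alpha> :: ('a, _, _) rep" and ?W = "SymSym b \<beta> :: ('a, _, _) rep"
  define f where "f = (\<lambda>(t, u) p. Ev a \<alpha> t (h p) * Ev b \<beta> u (k p))"
  interpret E: Vector_Spaces.linear fscale gscale "Ev R d :: _ \<Rightarrow> 'a point list \<Rightarrow> _" for R d
      by (rule linear_Ev)
  have "bilinear_into ?V ?W gscale f"
    by (auto simp: bilinear_into_def f_def E.add E.scale algebra_simps fun_eq_iff gscale_def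
        pscale_mult_left pscale_mult_right)
  from tensor_universal[OF vector_space_gscale this]
  obtain L where L: "Vector_Spaces.linear fscale gscale L"
    and Lf: "\<And>t u. t \<in> vecs ?V \<Longrightarrow> u \<in> vecs ?W \<Longrightarrow> L (pure2 ?V ?W (t, u)) = f (t, u)" by blast
  have "(L \<circ> act (?V \<otimes> ?W) g) x = (\<lambda>p. L x (map (act_point g) p))" if x: "x \<in> vecs (?V \<otimes> ?W)"
      for x g
  proof (rule linear_eq_on[where g =
      "\<lambda>x p. L x (map (act_point g) p)", OF _ _ x[unfolded vecs_tensor]])
    show "Vector_Spaces.linear fscale gscale (L \<circ> act (?V \<otimes> ?W) g)"
      unfolding act_tensor by (rule Vector_Spaces.linear_compose[OF linear_push L])
    show "Vector_Spaces.linear fscale gscale (\<lambda>x p. L x (map (act_point g) p))"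
      by (rule linear_gscale_comp[OF L])
    fix y assume "y \<in> pure2 ?V ?W ` (vecs ?V \<times> vecs ?W)"
    then obtain t u where t: "t \<in> vecs ?V" and u: "u \<in> vecs ?W" and y: "y = pure2 ?V ?W (t, u)"
        by auto
    have "act ?V g t \<in> vecs ?V" "act ?W g u \<in> vecs ?W"
      using t u linear_end_SymSym[of a \<alpha> g] linear_end_SymSym[of b \<beta> g] unfolding linear_end_def
          by blast+
    then show "(L \<circ> act (?V \<otimes> ?W) g) y = (\<lambda>p. L y (map (act_point g) p))"
      by (simp add: y act_tensor push_pure2 linear_end_SymSym Lf t u f_def Ev_act h k)
  qed
  then show thesis
    using L Lf by (intro that[of L]) (auto simp: f_def fun_eq_iff)
qed

text \<open>Dehomogenization: at points \<open>(z, 1)\<close> the function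
  \<open>hsym d \<mu>\<close> is the ordinary monomial symmetric polynomial.\<close>

definition affine_points :: "'a::field poly poly list \<Rightarrow> 'a point list" where
  "affine_points zs = map (\<lambda>z. (z, 1)) zs"

lemma length_affine_points [simp]: "length (affine_points zs) = length zs"
  by (simp add: affine_points_def)

text \<open>This is \<open>vanish_on_distinct\<close> for coefficients that depend on
  \<open>e\<close> only through its multiset. The coefficients are polynomials rather than scalars
  because in the applications they are values at other points.\<close>

lemma hsym_independent:
  fixes \<kappa> :: "nat multiset \<Rightarrow> 'a::field poly poly"
  assumes S: "finite S" "R + d \<le> card S"
    and 0: "\<And>xs. length xs = R \<Longrightarrow> distinct xs \<Longrightarrow> set xs \<subseteq> S \<Longrightarrow>
      (\<Sum>\<mu>\<in>exp_msets R d. \<kappa> \<mu> * hsym d \<mu> (affine_points xs)) = 0"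
    and \<mu>: "\<mu> \<in> exp_msets R d"
  shows "\<kappa> \<mu> = 0"
proof -
  obtain e where e: "mset e = \<mu>" using ex_mset by blast
  have "\<kappa> (mset e) = 0"
  proof (rule vanish_on_distinct[OF S])
    show "e \<in> exps R d" using mset_exps[OF \<mu>] e by auto
    fix xs :: "'a poly poly list" assume xs: "length xs = R" "distinct xs" "set xs \<subseteq> S"
    have "(\<Sum>e\<in>exps R d. \<kappa> (mset e) * (\<Prod>i<R. xs ! i ^ (e ! i))) =
      (\<Sum>e\<in>exps R d. \<kappa> (mset e) * hpower d (affine_points xs) e)"
      using xs by (intro sum.cong) (auto simp: hpower_def affine_points_def exps_length)
    also have "\<dots> = (\<Sum>\<mu>\<in>exp_msets R d. \<Sum>e | e \<in> exps R d \<and>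
        mset e = \<mu>. \<kappa> (mset e) * hpower d (affine_points xs) e)"
      by (rule sum.group[symmetric]) (auto simp: finite_exp_msets mset_in_exp_msets)
    also have "\<dots> = (\<Sum>\<mu>\<in>exp_msets R d. \<kappa> \<mu> * hsym d \<mu> (affine_points xs))"
      unfolding hsym_def sum_distrib_left
      using mset_exps by (intro sum.cong refl) (auto simp: subset_iff)
    also have "\<dots> = 0" by (rule 0[OF xs])
    finally show "(\<Sum>e\<in>exps R d. \<kappa> (mset e) * (\<Prod>i<R. xs ! i ^ (e ! i))) = 0" .
  qed
  then show ?thesis by (simp add: e)
qed

text \<open>The powers of the outer variable are infinitely many elements, so a large enough
  \<open>S\<close> exists over every field.\<close>

lemma hsym_independent_UNIV:
  fixes \<kappa> :: "nat multiset \<Rightarrow> 'a::field poly poly"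
  assumes "\<And>xs. length xs = R \<Longrightarrow> distinct xs \<Longrightarrow>
      (\<Sum>\<mu>\<in>exp_msets R d. \<kappa> \<mu> * hsym d \<mu> (affine_points xs)) = 0"
    and "\<mu> \<in> exp_msets R d"
  shows "\<kappa> \<mu> = 0"
proof -
  have "inj (monom 1 :: nat \<Rightarrow> 'a poly poly)"
    by (rule injI) (auto simp: monom_eq_iff')
  from infinite_super[OF subset_UNIV range_inj_infinite[OF this]] obtain S :: "'a poly poly set"
      where S: "finite S" "card S = R + d"
    using infinite_arbitrarily_large by blast
  show ?thesis by (rule hsym_independent[where S = S]) (use S assms in auto)
qed

lemma pscale_eq_mult: "pscale c p = [:[:c:]:] * p"
  by (simp add: pscale_def)

lemma hsym_independent_base:
  fixes u :: "nat multiset \<Rightarrow> 'a::field"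
  assumes "\<And>xs. length xs = R \<Longrightarrow> distinct xs \<Longrightarrow>
      (\<Sum>\<mu>\<in>exp_msets R d. pscale (u \<mu>) (hsym d \<mu> (affine_points xs))) = 0"
    and "\<mu> \<in> exp_msets R d"
  shows "u \<mu> = 0"
proof -
  have "[:[:u \<mu>:]:] = 0"
    using assms
    by (intro hsym_independent_UNIV[where \<kappa> = "\<lambda>\<mu>. [:[:u \<mu>:]:]" and R = R and d = d])
      (auto simp: pscale_eq_mult)
  then show ?thesis by simp
qed

text \<open>Injectivity of multiplication, on basis elements. For fixed distinct \<open>zs\<close>,
  the relation at \<open>xs @ ys\<close> is a relation among the functions
  \<open>hsym N \<mu>\<close> of \<open>xs\<close>, whose coefficients are values at
  \<open>zs\<close>; these must vanish, and then so do the scalars.\<close>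

lemma product_independent_left:
  fixes u :: "nat multiset \<times> nat multiset \<Rightarrow> 'a::field"
  assumes 0: "\<And>p :: 'a point list. length p = M + N \<Longrightarrow>
      (\<Sum>(\<mu>, \<nu>)\<in>exp_msets M N \<times> exp_msets (M + N) d. pscale (u (\<mu>, \<nu>)) (hsym N \<mu> (take M p) *
          hsym d \<nu> p)) = 0"
    and "\<mu> \<in> exp_msets M N" "\<nu> \<in> exp_msets (M + N) d"
  shows "u (\<mu>, \<nu>) = 0"
proof (rule hsym_independent_base[where u = "\<lambda>\<nu>. u (\<mu>, \<nu>)"])
  fix zs :: "'a poly poly list" assume zs: "length zs = M + N" "distinct zs"
  \<comment> \<open>With \<open>S\<close> the set of entries of \<open>zs\<close>, the bound of
    \<open>hsym_independent\<close> holds with equality.\<close>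
  show "(\<Sum>\<nu>\<in>exp_msets (M + N) d. pscale (u (\<mu>, \<nu>)) (hsym d \<nu> (affine_points zs))) = 0"
  proof (rule hsym_independent[where S = "set zs" and R = M and d = N])
    show "M + N \<le> card (set zs)" using zs by (simp add: distinct_card)
    fix xs :: "'a poly poly list" assume xs: "length xs = M" "distinct xs" "set xs \<subseteq> set zs"
    \<comment> \<open>The remaining \<open>N\<close> members of \<open>zs\<close>: symmetry makes
      the second factor at \<open>xs @ ys\<close> equal to its value at \<open>zs\<close>, whichever
      \<open>xs\<close> was chosen.\<close>
    define ys where "ys = filter (\<lambda>z. z \<notin> set xs) zs"
    have mset: "mset (xs @ ys) = mset zs"
      using xs zs by (intro iffD1[OF set_eq_iff_mset_eq_distinct]) (auto simp: ys_def)
    have mset': "mset (affine_points (xs @ ys)) = mset (affine_points zs)"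
      by (simp only: affine_points_def mset_map mset)
    have "hsym d \<nu> (affine_points (xs @ ys)) = hsym d \<nu> (affine_points zs)"
        if "\<nu> \<in> exp_msets (M + N) d" for \<nu>
      using that zs mset_eq_length[OF mset] by (intro hsym_permute mset')
          (simp add: multisets_of_size_def)
    then have "(\<Sum>\<mu>\<in>exp_msets M N. (\<Sum>\<nu>\<in>exp_msets (M + N) d. pscale (u (\<mu>, \<nu>))
        (hsym d \<nu> (affine_points zs))) * hsym N \<mu> (affine_points xs))
      = (\<Sum>(\<mu>, \<nu>)\<in>exp_msets M N \<times> exp_msets (M + N) d. pscale (u (\<mu>, \<nu>))
          (hsym N \<mu> (take M (affine_points (xs @ ys))) * hsym d \<nu> (affine_points (xs @ ys))))"
      using xs by (simp add: sum.cartesian_product[symmetric] sum_distrib_right sum_distrib_left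
          affine_points_def
          pscale_mult_left pscale_mult_right mult.commute)
    also have "\<dots> = 0"
      using mset_eq_length[OF mset] zs by (intro 0) simp
    finally show "(\<Sum>\<mu>\<in>exp_msets M N. (\<Sum>\<nu>\<in>exp_msets (M + N) d. pscale (u (\<mu>, \<nu>))
        (hsym d \<nu> (affine_points zs))) * hsym N \<mu> (affine_points xs)) = 0" .
  qed (use assms in auto)
qed fact

text \<open>Here the two factors involve disjoint sets of points, so independence is used first in
  \<open>ys\<close> with \<open>xs\<close> fixed, then in \<open>xs\<close>.\<close>

lemma product_independent_right:
  fixes u :: "nat multiset \<times> nat multiset \<Rightarrow> 'a::field"
  assumes 0: "\<And>p :: 'a point list. length p = M + N \<Longrightarrow>
      (\<Sum>(\<alpha>, \<beta>)\<in>exp_msets N c \<times> exp_msets M d. pscale (u (\<alpha>, \<beta>)) (hsym c \<alpha> (drop M p) *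
          hsym d \<beta> (take M p))) = 0"
    and "\<alpha> \<in> exp_msets N c" "\<beta> \<in> exp_msets M d"
  shows "u (\<alpha>, \<beta>) = 0"
proof (rule hsym_independent_base[where u = "\<lambda>\<beta>. u (\<alpha>, \<beta>)"])
  fix xs :: "'a poly poly list" assume xs: "length xs = M"
  show "(\<Sum>\<beta>\<in>exp_msets M d. pscale (u (\<alpha>, \<beta>)) (hsym d \<beta> (affine_points xs))) = 0"
  proof (rule hsym_independent_UNIV[where R = N and d = c])
    fix ys :: "'a poly poly list" assume ys: "length ys = N"
    have "(\<Sum>\<alpha>\<in>exp_msets N c. (\<Sum>\<beta>\<in>exp_msets M d. pscale (u (\<alpha>, \<beta>)) (hsym d \<beta> (affine_points xs))) *
        hsym c \<alpha> (affine_points ys))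
      = (\<Sum>(\<alpha>, \<beta>)\<in>exp_msets N c \<times> exp_msets M d. pscale (u (\<alpha>, \<beta>))
          (hsym c \<alpha> (drop M (affine_points (xs @ ys))) *
              hsym d \<beta> (take M (affine_points (xs @ ys)))))"
      using xs by (simp add: sum.cartesian_product[symmetric] sum_distrib_right sum_distrib_left
          affine_points_def
          pscale_mult_left pscale_mult_right mult.commute)
    also have "\<dots> = 0" using xs ys by (intro 0) simp
    finally show "(\<Sum>\<alpha>\<in>exp_msets N c. (\<Sum>\<beta>\<in>exp_msets M d. pscale (u (\<alpha>, \<beta>)) (hsym d \<beta>
        (affine_points xs))) * hsym c \<alpha> (affine_points ys)) = 0" .
  qed (use assms in auto)
qed fact

section \<open>Products of orbit sums\<close>

lemma exp_msets_iff: "\<mu> \<in> exp_msets R d \<longleftrightarrow> size \<mu> = R \<and> set_mset \<mu> \<subseteq> {..d}"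
  by (auto simp: multisets_of_size_def)

lemma finite_mset_eq [simp]: "finite {e. mset e = \<mu>}"
proof (rule finite_subset)
  show "{e. mset e = \<mu>} \<subseteq> {e. set e \<subseteq> set_mset \<mu> \<and> length e = size \<mu>}" by auto
qed (simp add: finite_lists_length_eq)

lemma hpower_append:
  "length e = length p \<Longrightarrow> hpower d (p @ q) (e @ f) = hpower d p e * hpower d q f"
proof (induction e arbitrary: p)
  case (Cons a e)
  then obtain x p' where "p = x # p'" by (cases p) auto
  with Cons show ?case
    by (simp add: hpower_def prod.lessThan_Suc_shift mult.assoc del: prod.lessThan_Suc)
qed (simp add: hpower_def)

text \<open>The coproduct rule: a rearrangement of \<open>\<nu>\<close> is cut after
  \<open>M\<close> entries, and the multiset \<open>\<alpha>\<close> of the first piece determines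
  that of the second.\<close>

lemma hsym_split:
  assumes p: "length p = M + N" and \<nu>: "\<nu> \<in> exp_msets (M + N) d"
  shows "hsym d \<nu> p =
      (\<Sum>\<alpha> | \<alpha> \<in> exp_msets M d \<and> \<alpha> \<subseteq># \<nu>. hsym d \<alpha> (take M p) * hsym d (\<nu> - \<alpha>) (drop M p))"
proof -
  let ?A = "{\<alpha>. \<alpha> \<in> exp_msets M d \<and> \<alpha> \<subseteq># \<nu>}"
  let ?B = "\<lambda>\<alpha>. {e. mset e = \<alpha>} \<times> {f. mset f = \<nu> - \<alpha>}"
  have "hsym d \<nu> p = (\<Sum>(\<alpha>, e, f)\<in>Sigma ?A ?B. hpower d (take M p) e * hpower d (drop M p) f)"
    unfolding hsym_def
  proof (rule sum.reindex_bij_witness[where j = "\<lambda>e. (mset (take M e), take M e, drop M e)"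
      and i = "\<lambda>(\<alpha>, e, f). e @ f"])
    fix e assume "e \<in> {e. mset e = \<nu>}"
    then have e: "mset e = \<nu>" by simp
    then have len: "length e = M + N" and sub: "set e \<subseteq> {..d}" using \<nu> by (auto simp: exp_msets_iff)
    have split: "mset (take M e) + mset (drop M e) = \<nu>" by (simp add: e flip: mset_append)
    then show "(mset (take M e), take M e, drop M e) \<in> Sigma ?A ?B"
      using len sub by (auto simp: exp_msets_iff dest: in_set_takeD)
    have "hpower d (take M p @ drop M p) (take M e @ drop M e) =
        hpower d (take M p) (take M e) * hpower d (drop M p) (drop M e)"
      using len p by (intro hpower_append) simp
    then show "(case (mset (take M e), take M e, drop M e) of (\<alpha>, e, f) \<Rightarrow>
        hpower d (take M p) e * hpower d (drop M p) f) = hpower d p e" by simp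
  qed (auto simp: exp_msets_iff)
  also have "\<dots> = (\<Sum>\<alpha>\<in>?A. \<Sum>(e, f)\<in>?B \<alpha>. hpower d (take M p) e * hpower d (drop M p) f)"
    by (rule sum.Sigma[symmetric]) (auto simp: finite_exp_msets)
  also have "\<dots> = (\<Sum>\<alpha>\<in>?A. hsym d \<alpha> (take M p) * hsym d (\<nu> - \<alpha>) (drop M p))"
    by (simp add: hsym_def sum_product sum.cartesian_product)
  finally show ?thesis .
qed

text \<open>Its cardinality is the structure constant of the product of two monomial symmetric
  polynomials at the monomial \<open>f\<close>.\<close>

definition sums_to :: "nat multiset \<Rightarrow> nat multiset \<Rightarrow> nat list \<Rightarrow> (nat list \<times> nat list) set" where
  "sums_to \<mu> \<alpha> f = {(e, e'). mset e = \<mu> \<and> mset e' = \<alpha> \<and> map2 (+) e e' = f}"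

lemma sums_to_permute:
  assumes "size \<mu> = R" "size \<alpha> = R" "\<sigma> permutes {..<R}" "x \<in> sums_to \<mu> \<alpha> f"
  shows "map_prod (permute_list \<sigma>) (permute_list \<sigma>) x \<in> sums_to \<mu> \<alpha> (permute_list \<sigma> f)"
  using assms by (auto simp: sums_to_def permute_list_zip permute_list_map)

text \<open>Permuting both lists of a pair by the same \<open>\<sigma>\<close> injects one set into
  the other. Exchanging \<open>f\<close> and \<open>f'\<close> gives equality.\<close>

lemma card_sums_to:
  assumes R: "size \<mu> = R" "size \<alpha> = R" and f: "mset f = mset f'"
  shows "card (sums_to \<mu> \<alpha> f) \<le> card (sums_to \<mu> \<alpha> f')"
proof (cases "sums_to \<mu> \<alpha> f = {}")
  case False
  then have len: "length f = R" using R by (auto simp: sums_to_def)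
  obtain \<sigma> where \<sigma>: "\<sigma> permutes {..<R}" "permute_list \<sigma> f = f'"
    using mset_eq_permutation[OF f[symmetric]] len by auto
  let ?h = "map_prod (permute_list \<sigma>) (permute_list \<sigma>) :: nat list \<times> nat list \<Rightarrow> _"
  have "inj_on ?h (sums_to \<mu> \<alpha> f)"
  proof (rule inj_on_inverseI)
    fix x assume "x \<in> sums_to \<mu> \<alpha> f"
    then have "length (fst x) = R" "length (snd x) = R" using R by (auto simp: sums_to_def)
    then show "map_prod (permute_list (inv \<sigma>)) (permute_list (inv \<sigma>)) (?h x) = x"
      using \<sigma>(1) permutes_inv[OF \<sigma>(1)]
      by (cases x) (simp add: permute_list_compose[symmetric] permutes_inv_o)
  qed
  moreover have "?h ` sums_to \<mu> \<alpha> f \<subseteq> sums_to \<mu> \<alpha> f'"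
  proof (rule image_subsetI)
    fix x assume "x \<in> sums_to \<mu> \<alpha> f"
    from sums_to_permute[OF R \<sigma>(1) this] show "?h x \<in> sums_to \<mu> \<alpha> f'" by (simp add: \<sigma>(2))
  qed
  moreover have "finite (sums_to \<mu> \<alpha> f')"
    by (rule finite_subset[of _ "{e. mset e = \<mu>} \<times> {e. mset e = \<alpha>}"]) (auto simp: sums_to_def)
  ultimately show ?thesis by (rule card_inj_on_le)
qed simp

text \<open>The bounds on the exponents keep the natural subtractions exact, so the exponents of the
  second coordinates add up too.\<close>

lemma hpower_mult:
  assumes "length e = length p" "length f = length p" "set e \<subseteq> {..a}" "set f \<subseteq> {..b}"
  shows "hpower a p e * hpower b p f = hpower (b + a) p (map2 (+) e f)"
proof -
  have "fst (p ! i) ^ (e ! i) * snd (p ! i) ^ (a - e ! i) * (fst (p ! i) ^ (f ! i) * snd (p ! i) ^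
      (b - f ! i)) =
    fst (p ! i) ^ (e ! i + f ! i) * snd (p ! i) ^ (b + a - (e ! i + f ! i))" if "i < length p" for i
  proof -
    have "e ! i \<in> set e" "f ! i \<in> set f" using that assms(1,2) by simp_all
    then have "e ! i \<le> a" "f ! i \<le> b" using assms(3,4) by blast+
    then have "b + a - (e ! i + f ! i) = (a - e ! i) + (b - f ! i)" by simp
    then show ?thesis by (simp add: power_add mult_ac)
  qed
  then show ?thesis using assms by (simp add: hpower_def flip: prod.distrib)
qed

text \<open>Expand both orbit sums and collect pairs by their sum \<open>f\<close>. The number of
  pairs depends only on the multiset of \<open>f\<close>, so the result is a combination of orbit
  sums, with constants independent of \<open>p\<close>.\<close>

lemma hsym_mult:
  fixes M a b :: nat
  assumes \<mu>: "\<mu> \<in> exp_msets M a" and \<alpha>: "\<alpha> \<in> exp_msets M b"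
  obtains n :: "nat multiset \<Rightarrow> 'a::field" where
    "\<And>p :: 'a point list. length p = M \<Longrightarrow>
      hsym a \<mu> p * hsym b \<alpha> p = (\<Sum>\<beta>\<in>exp_msets M (b + a). pscale (n \<beta>) (hsym (b + a) \<beta> p))"
proof -
  \<comment> \<open>The count at a chosen arrangement of \<open>\<beta>\<close>, mapped into the
    field, where it may become zero.\<close>
  define n :: "nat multiset \<Rightarrow> 'a" where "n \<beta> = of_nat (card (sums_to \<mu> \<alpha> (SOME f. mset f = \<beta>)))"
      for \<beta>
  have n: "n (mset f) = of_nat (card (sums_to \<mu> \<alpha> f))" for f
  proof -
    have "mset (SOME f'. mset f' = mset f) = mset f" by (rule someI[of _ f]) simp
    then show ?thesis
      using \<mu> \<alpha> unfolding n_def exp_msets_iff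
      by (intro arg_cong[where f = of_nat] antisym card_sums_to) auto
  qed
  have "hsym a \<mu> p * hsym b \<alpha> p = (\<Sum>\<beta>\<in>exp_msets M (b + a). pscale (n \<beta>) (hsym (b + a) \<beta> p))"
    if p: "length p = M" for p :: "'a point list"
  proof -
    let ?P = "{e. mset e = \<mu>} \<times> {e. mset e = \<alpha>}"
    have sum_in: "map2 (+) (fst x) (snd x) \<in> exps M (b + a)" if "x \<in> ?P" for x
    proof -
      have "fst x \<in> exps M a" "snd x \<in> exps M b" using that mset_exps[OF \<mu>] mset_exps[OF \<alpha>] by auto
      then show ?thesis by (fastforce simp: exps_def dest: set_zip_leftD set_zip_rightD
          intro: add_mono)
    qed
    have "hsym a \<mu> p * hsym b \<alpha> p = (\<Sum>x\<in>?P. hpower a p (fst x) * hpower b p (snd x))"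
      by (simp add: hsym_def sum_product sum.cartesian_product case_prod_unfold)
    also have "\<dots> = (\<Sum>x\<in>?P. hpower (b + a) p (map2 (+) (fst x) (snd x)))"
    proof (intro sum.cong refl hpower_mult)
      fix x assume "x \<in> ?P"
      then have "fst x \<in> exps M a" "snd x \<in> exps M b" using mset_exps[OF \<mu>] mset_exps[OF \<alpha>] by auto
      then show "length (fst x) = length p"
          "length (snd x) = length p" "set (fst x) \<subseteq> {..a}" "set (snd x) \<subseteq> {..b}"
        using p by (simp_all add: exps_def)
    qed
    also have "\<dots> = (\<Sum>f\<in>exps M (b + a). \<Sum>x | x \<in> ?P \<and>
        map2 (+) (fst x) (snd x) = f. hpower (b + a) p (map2 (+) (fst x) (snd x)))"
      using sum_in by (intro sum.group[symmetric]) auto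
    also have "\<dots> = (\<Sum>f\<in>exps M (b + a). pscale (n (mset f)) (hpower (b + a) p f))"
    proof (rule sum.cong[OF refl])
      fix f
      have "{x. x \<in> ?P \<and> map2 (+) (fst x) (snd x) = f} = sums_to \<mu> \<alpha> f" by (auto simp: sums_to_def)
      then have "(\<Sum>x | x \<in> ?P \<and>
          map2 (+) (fst x) (snd x) = f. hpower (b + a) p (map2 (+) (fst x) (snd x)))
        = (\<Sum>x\<in>sums_to \<mu> \<alpha> f. hpower (b + a) p f)"
        by (intro sum.cong) (auto simp: sums_to_def)
      then show "(\<Sum>x | x \<in> ?P \<and>
          map2 (+) (fst x) (snd x) = f. hpower (b + a) p (map2 (+) (fst x) (snd x)))
        = pscale (n (mset f)) (hpower (b + a) p f)"
        by (simp add: n pscale_eq_mult of_nat_poly)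
    qed
    also have "\<dots> = (\<Sum>\<beta>\<in>exp_msets M (b + a). \<Sum>f | f \<in> exps M (b + a) \<and>
        mset f = \<beta>. pscale (n (mset f)) (hpower (b + a) p f))"
      by (rule sum.group[symmetric]) (auto simp: finite_exp_msets mset_in_exp_msets)
    also have "\<dots> = (\<Sum>\<beta>\<in>exp_msets M (b + a). pscale (n \<beta>) (hsym (b + a) \<beta> p))"
      unfolding hsym_def pscale.scale_sum_right
      using mset_exps by (intro sum.cong refl) (auto simp: subset_iff)
    finally show ?thesis .
  qed
  then show thesis by (rule that)
qed

text \<open>Counting multisets gives a product of two binomial coefficients on each side; both
  choose disjoint sets of sizes \<open>M\<close> and \<open>N\<close> out of
  \<open>d + M + N\<close> elements.\<close>

lemma card_exp_msets: "card (exp_msets M N \<times> exp_msets (M + N) d) =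
    card (exp_msets N d \<times> exp_msets M (d + N))"
proof -
  have exp_msets: "card (exp_msets R d) = (d + R) choose R" for R d
      by (simp add: card_multisets_of_size)
  have "((d + (M + N)) choose (M + N)) * ((M + N) choose M) =
      ((d + (M + N)) choose M) * ((d + (M + N) - M) choose (M + N - M))"
    by (rule choose_mult) auto
  then show ?thesis by (simp add: exp_msets card_cartesian_product mult.commute ac_simps)
qed

section \<open>Isomorphisms from a common realization\<close>

context vector_space
begin

text \<open>Independence of an indexed family also excludes repetitions, which is what permits
  comparing cardinalities of index sets.\<close>

lemma family_independent:
  assumes I: "finite I" and 0: "\<And>u. (\<Sum>i\<in>I. scale (u i) (F i)) = 0 \<Longrightarrow> \<forall>i\<in>I. u i = 0"
  shows "inj_on F I" "independent (F ` I)"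
proof -
  show inj: "inj_on F I"
  proof (rule inj_onI, rule ccontr)
    fix i j assume ij: "i \<in> I" "j \<in> I" "F i = F j" "i \<noteq> j"
    \<comment> \<open>The relation \<open>F i - F j = 0\<close>.\<close>
    let ?u = "\<lambda>k. if k = i then 1 else if k = j then -1 else 0"
    have "(\<Sum>k\<in>I. scale (?u k) (F k)) = (\<Sum>k\<in>{i, j}. scale (?u k) (F k))"
      using I ij by (intro sum.mono_neutral_right) auto
    also have "\<dots> = 0" using ij by simp
    finally show False using 0[of ?u] ij(1) by auto
  qed
  show "independent (F ` I)"
  proof (rule independent_if_scalars_zero)
    fix f x assume "(\<Sum>x\<in>F ` I. scale (f x) x) = 0" "x \<in> F ` I"
    then show "f x = 0" using 0[of "f \<circ> F"] by (auto simp: sum.reindex[OF inj])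
  qed (use I in simp)
qed

text \<open>A member of \<open>T\<close> outside the span of \<open>S\<close> would enlarge
  \<open>S\<close> to an independent set with more elements than \<open>T\<close> in the span of
  \<open>T\<close>.\<close>

lemma span_eq_if_card_eq:
  assumes "finite T" "independent S" "S \<subseteq> span T" "card S = card T"
  shows "span S = span T"
proof (rule antisym)
  show "span S \<subseteq> span T" using assms(3) by (simp add: span_minimal)
  have "T \<subseteq> span S"
  proof
    fix x assume x: "x \<in> T"
    show "x \<in> span S"
    proof (rule ccontr)
      assume n: "x \<notin> span S"
      then have "independent (insert x S)" using assms(2) by (simp add: independent_insertI)
      moreover have "insert x S \<subseteq> span T" using assms(3) span_base[OF x] by simp
      ultimately have "finite (insert x S)" "card (insert x S) \<le> card T"
        using independent_span_bound[OF assms(1), of "insert x S"] by auto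
      moreover have "x \<notin> S" using n span_base[of x S] by auto
      ultimately show False using assms(4) by simp
    qed
  qed
  then show "span T \<subseteq> span S" by (simp add: span_minimal)
qed

end

lemma inj_on_span_family:
  assumes L: "Vector_Spaces.linear s s' L" and I: "finite I"
    and 0: "\<And>u. (\<Sum>i\<in>I. s' (u i) (L (a i))) = 0 \<Longrightarrow> \<forall>i\<in>I. u i = 0"
  shows "inj_on L (module.span s (a ` I))"
proof -
  interpret L: Vector_Spaces.linear s s' L by fact
  have "inj_on (\<lambda>i. L (a i)) I" by (rule L.vs2.family_independent[OF I 0])
  then have inj: "inj_on a I" by (auto simp: inj_on_def)
  have "x = 0" if x: "x \<in> L.vs1.span (a ` I)" "L x = 0" for x
  proof -
    obtain u where u: "x = (\<Sum>v\<in>a ` I. s (u v) v)" using x(1) L.vs1.span_finite[of "a ` I"] I by auto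
    then have x': "x = (\<Sum>i\<in>I. s (u (a i)) (a i))" by (simp add: sum.reindex[OF inj])
    have "(\<Sum>i\<in>I. s' (u (a i)) (L (a i))) = 0" using x(2) unfolding x' by (simp add: L.sum L.scale)
    then have "\<forall>i\<in>I. u (a i) = 0" by (rule 0)
    then show "x = 0" by (simp add: x')
  qed
  then show ?thesis
    by (intro inj_onI) (metis L.diff L.vs1.span_diff right_minus_eq)
qed

text \<open>Both representations embed in one space, and the images agree: one lies in the other and
  the dimensions are equal. The isomorphism is \<open>L\<close> followed by the inverse of
  \<open>K\<close>, equivariant because both embeddings turn the action into the same
  \<open>A\<close>.\<close>

lemma rep_isomorphic_via_realization:
  fixes V :: "('a::field, 'g, 'v::ab_group_add) rep" and W :: "('a, 'g, 'w::ab_group_add) rep"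
    and s :: "'a \<Rightarrow> 'u::ab_group_add \<Rightarrow> 'u"
  assumes L: "Vector_Spaces.linear (scl V) s L" and K: "Vector_Spaces.linear (scl W) s K"
    and V: "vecs V = module.span (scl V) (a ` I)" and W: "vecs W = module.span (scl W) (b ` J)"
    and fin: "finite I" "finite J" and card: "card I = card J"
    and L0: "\<And>u. (\<Sum>i\<in>I. s (u i) (L (a i))) = 0 \<Longrightarrow> \<forall>i\<in>I. u i = 0"
    and K0: "\<And>u. (\<Sum>j\<in>J. s (u j) (K (b j))) = 0 \<Longrightarrow> \<forall>j\<in>J. u j = 0"
    and LK: "\<And>i. i \<in> I \<Longrightarrow> L (a i) \<in> module.span s ((\<lambda>j. K (b j)) ` J)"
    and Vg: "\<And>g x. x \<in> vecs V \<Longrightarrow> act V g x \<in> vecs V \<and> L (act V g x) = A g (L x)"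
    and Wg: "\<And>g x. x \<in> vecs W \<Longrightarrow> act W g x \<in> vecs W \<and> K (act W g x) = A g (K x)"
  shows "rep_isomorphic G V W"
proof -
  interpret L: Vector_Spaces.linear "scl V" s L by fact
  interpret K: Vector_Spaces.linear "scl W" s K by fact
  have injL: "inj_on L (vecs V)" unfolding V by (rule inj_on_span_family[OF L fin(1) L0])
  have injK: "inj_on K (vecs W)" unfolding W by (rule inj_on_span_family[OF K fin(2) K0])
  have "L.vs2.span ((\<lambda>i. L (a i)) ` I) = L.vs2.span ((\<lambda>j. K (b j)) ` J)"
  proof (rule L.vs2.span_eq_if_card_eq)
    show "card ((\<lambda>i. L (a i)) ` I) = card ((\<lambda>j. K (b j)) ` J)"
      using L.vs2.family_independent(1)[OF fin(1) L0] L.vs2.family_independent(1)[OF fin(2) K0] card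
      by (simp add: card_image)
  qed (use fin LK L.vs2.family_independent(2)[OF fin(1) L0] in auto)
  then have im: "L ` vecs V = K ` vecs W"
    unfolding V W by (simp add: L.span_image[symmetric] K.span_image[symmetric] image_image)
  define \<phi> where "\<phi> = the_inv_into (vecs W) K \<circ> L"
  have \<phi>: "\<phi> x \<in> vecs W" "K (\<phi> x) = L x" if "x \<in> vecs V" for x
  proof -
    have "L x \<in> K ` vecs W" using that im by blast
    then show "\<phi> x \<in> vecs W" "K (\<phi> x) = L x"
      by (auto simp: \<phi>_def f_the_inv_into_f[OF injK] intro!: the_inv_into_into[OF injK])
  qed
  \<comment> \<open>By injectivity of \<open>K\<close>, each property of \<open>\<phi>\<close> can
    be checked after applying \<open>K\<close>, where it is a property of \<open>L\<close>.\<close>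
  have eq: "\<phi> x = y" if "x \<in> vecs V" "y \<in> vecs W" "L x = K y" for x y
    using that \<phi>[of x] by (intro inj_onD[OF injK]) auto
  have subs: "L.vs1.subspace (vecs V)" "K.vs1.subspace (vecs W)" by (simp_all add: V W)
  have "bij_betw \<phi> (vecs V) (vecs W)"
    unfolding \<phi>_def
    by (intro bij_betw_trans[of L _ "K ` vecs W"] bij_betw_the_inv_into)
      (auto simp: bij_betw_def injL injK im)
  moreover have "\<phi> (x + y) = \<phi> x + \<phi> y" if "x \<in> vecs V" "y \<in> vecs V" for x y
    using that \<phi> L.vs1.subspace_add[OF subs(1)] K.vs1.subspace_add[OF subs(2)]
    by (intro eq) (auto simp: L.add K.add)
  moreover have "\<phi> (scl V c x) = scl W c (\<phi> x)" if "x \<in> vecs V" for c x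
    using that \<phi> L.vs1.subspace_scale[OF subs(1)] K.vs1.subspace_scale[OF subs(2)]
    by (intro eq) (auto simp: L.scale K.scale)
  moreover have "\<phi> (act V g x) = act W g (\<phi> x)" if "x \<in> vecs V" for g x
    using that \<phi> Vg Wg by (intro eq) auto
  ultimately show ?thesis unfolding rep_isomorphic_def rep_isomorphism_def by blast
qed

theorem theorem1p2:
  fixes M N d :: nat
  shows "rep_isomorphic (SL2 :: ('a::field ^ 2 ^ 2) set)
           (Sym_lower M (Sym_upper_E N) \<otimes> Sym_lower (M + N) (Sym_upper_E d))
           (Sym_lower N (Sym_upper_E d) \<otimes> Sym_lower M (Sym_upper_E (d + N)))"
proof -
  let ?A = "SymSym M N :: ('a, _, _) rep" and ?B = "SymSym (M + N) d :: ('a, _, _) rep"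
  let ?C = "SymSym N d :: ('a, _, _) rep" and ?D = "SymSym M (d + N) :: ('a, _, _) rep"
  let ?I = "exp_msets M N \<times> exp_msets (M + N) d" and ?J = "exp_msets N d \<times> exp_msets M (d + N)"
  define a where "a = (\<lambda>(\<mu>, \<nu>). pure2 ?A ?B (mono_sym N \<mu>, mono_sym d \<nu>))"
  define b where "b = (\<lambda>(\<alpha>, \<beta>). pure2 ?C ?D (mono_sym d \<alpha>, mono_sym (d + N) \<beta>))"
  \<comment> \<open>The multiplication map of the left side: the first factor sees the first
    \<open>M\<close> points \<open>x\<close>, the second all \<open>M + N\<close> points.\<close>
  obtain L where L: "Vector_Spaces.linear fscale gscale L"
    "\<And>t u p. t \<in> vecs ?A \<Longrightarrow> u \<in> vecs ?B \<Longrightarrow> L (pure2 ?A ?B (t, u)) p =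
        Ev M N t (take M p) * Ev (M + N) d u p"
    "\<And>x g p. x \<in> vecs (?A \<otimes> ?B) \<Longrightarrow> L (act (?A \<otimes> ?B) g x) p = L x (map (act_point g) p)"
    by (rule tensor_realization[of "take M" "\<lambda>p. p"]) (auto simp: take_map)
  \<comment> \<open>The right side as functions of the same list: the first factor sees the last
    \<open>N\<close> points \<open>y\<close>, the second sees \<open>x\<close>.\<close>
  obtain K where K: "Vector_Spaces.linear fscale gscale K"
    "\<And>t u p. t \<in> vecs ?C \<Longrightarrow> u \<in> vecs ?D \<Longrightarrow> K (pure2 ?C ?D (t, u)) p =
        Ev N d t (drop M p) * Ev M (d + N) u (take M p)"
    "\<And>x g p. x \<in> vecs (?C \<otimes> ?D) \<Longrightarrow> K (act (?C \<otimes> ?D) g x) p = K x (map (act_point g) p)"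
    by (rule tensor_realization[of "drop M" "take M"]) (auto simp: take_map drop_map)
  have La: "L (a (\<mu>, \<nu>)) p = (if length p = M + N then hsym N \<mu> (take M p) * hsym d \<nu> p else 0)"
    if "\<mu> \<in> exp_msets M N" "\<nu> \<in> exp_msets (M + N) d" for \<mu> \<nu> p
    using that by (auto simp: a_def L(2) mono_sym_in Ev_mono_sym)
  have Kb: "K (b (\<alpha>, \<beta>)) p = (if length p =
      M + N then hsym d \<alpha> (drop M p) * hsym (d + N) \<beta> (take M p) else 0)"
    if "\<alpha> \<in> exp_msets N d" "\<beta> \<in> exp_msets M (d + N)" for \<alpha> \<beta> p
    using that by (auto simp: b_def K(2) mono_sym_in Ev_mono_sym)
  have ap: "(\<Sum>i\<in>S. F i) p = (\<Sum>i\<in>S. F i p)"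
    for F :: "nat multiset \<times> nat multiset \<Rightarrow> 'a point list \<Rightarrow> 'a poly poly" and S p
    by (induction S rule: infinite_finite_induct) auto
  \<comment> \<open>In both realizations \<open>g\<close> acts by moving all points, which is the
    common action \<open>A\<close>.\<close>
  show ?thesis
  proof (rule rep_isomorphic_via_realization[where L = L and K = K and s = gscale and a =
      a and b = b
        and I = ?I and J = ?J and A = "\<lambda>g F p. F (map (act_point g) p)"])
    show "vecs (?A \<otimes> ?B) = module.span (scl (?A \<otimes> ?B)) (a ` ?I)"
      by (subst tensor_eq_span[of ?A "mono_sym N ` exp_msets M N" ?B "mono_sym d ` exp_msets
          (M + N) d"])
        (auto simp: Sym_lower_eq_span vector_space_fscale a_def image_image intro!: arg_cong[where
            f = fscale.span])
    show "vecs (?C \<otimes> ?D) = module.span (scl (?C \<otimes> ?D)) (b ` ?J)"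
      by (subst tensor_eq_span[of ?C "mono_sym d ` exp_msets N d" ?D "mono_sym (d + N) ` exp_msets
          M (d + N)"])
        (auto simp: Sym_lower_eq_span vector_space_fscale b_def image_image intro!: arg_cong[where
            f = fscale.span])
    show "\<forall>i\<in>?I. u i = 0" if "(\<Sum>i\<in>?I. gscale (u i) (L (a i))) = 0" for u
    proof -
      have "(\<Sum>(\<mu>, \<nu>)\<in>?I. pscale (u (\<mu>, \<nu>)) (hsym N \<mu> (take M p) * hsym d \<nu> p)) = 0"
        if "length p = M + N" for p :: "'a point list"
      proof -
        have "(\<Sum>(\<mu>, \<nu>)\<in>?I. pscale (u (\<mu>, \<nu>)) (hsym N \<mu> (take M p) * hsym d \<nu> p)) =
            (\<Sum>i\<in>?I. gscale (u i) (L (a i))) p"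
          unfolding ap using that by (intro sum.cong) (auto simp: gscale_def La)
        then show ?thesis using \<open>(\<Sum>i\<in>?I. gscale (u i) (L (a i))) = 0\<close> by simp
      qed
      from product_independent_left[OF this] show ?thesis by auto
    qed
    show "\<forall>j\<in>?J. u j = 0" if "(\<Sum>j\<in>?J. gscale (u j) (K (b j))) = 0" for u
    proof -
      have "(\<Sum>(\<alpha>, \<beta>)\<in>?J. pscale (u (\<alpha>, \<beta>)) (hsym d \<alpha> (drop M p) * hsym (d + N) \<beta> (take M p))) = 0"
        if "length p = M + N" for p :: "'a point list"
      proof -
        have "(\<Sum>(\<alpha>, \<beta>)\<in>?J. pscale (u (\<alpha>, \<beta>)) (hsym d \<alpha> (drop M p) * hsym (d + N) \<beta> (take M p))) =
            (\<Sum>j\<in>?J. gscale (u j) (K (b j))) p"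
          unfolding ap using that by (intro sum.cong) (auto simp: gscale_def Kb)
        then show ?thesis using \<open>(\<Sum>j\<in>?J. gscale (u j) (K (b j))) = 0\<close> by simp
      qed
      from product_independent_right[OF this] show ?thesis by auto
    qed
    \<comment> \<open>The product lands in the right side: split the second factor between
      \<open>x\<close> and \<open>y\<close> by \<open>hsym_split\<close>, then multiply the two
      functions of \<open>x\<close> by \<open>hsym_mult\<close>.\<close>
    show "L (a i) \<in> gscale.span ((\<lambda>j. K (b j)) ` ?J)" if i_in: "i \<in> ?I" for i
    proof -
      obtain \<mu> \<nu> where i: "i = (\<mu>, \<nu>)" and \<mu>: "\<mu> \<in> exp_msets M N" and \<nu>: "\<nu> \<in> exp_msets (M + N) d"
        using i_in by auto
      let ?S = "{\<alpha>. \<alpha> \<in> exp_msets M d \<and> \<alpha> \<subseteq># \<nu>}"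
      have "\<exists>n :: nat multiset \<Rightarrow> 'a. \<forall>p :: 'a point list. length p = M \<longrightarrow> hsym N \<mu> p * hsym d \<alpha> p =
          (\<Sum>\<beta>\<in>exp_msets M (d + N). pscale (n \<beta>) (hsym (d + N) \<beta> p))" if "\<alpha> \<in> exp_msets M d" for \<alpha>
        by (rule hsym_mult[OF \<mu> that]) auto
      then have "\<forall>\<alpha>\<in>exp_msets M d. \<exists>n :: nat multiset \<Rightarrow> 'a. \<forall>p :: 'a point list. length p = M \<longrightarrow>
          hsym N \<mu> p * hsym d \<alpha> p = (\<Sum>\<beta>\<in>exp_msets M (d + N). pscale (n \<beta>) (hsym (d + N) \<beta> p))"
        by (intro ballI)
      from bchoice[OF this] obtain n :: "nat multiset \<Rightarrow> nat multiset \<Rightarrow> 'a" where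
        n: "hsym N \<mu> p * hsym d \<alpha> p = (\<Sum>\<beta>\<in>exp_msets M (d + N). pscale (n \<alpha> \<beta>) (hsym (d + N) \<beta> p))"
        if "\<alpha> \<in> exp_msets M d" "length p = M" for \<alpha> and p :: "'a point list" by auto
      have diff: "\<nu> - \<alpha> \<in> exp_msets N d" if "\<alpha> \<in> ?S" for \<alpha>
        using that \<nu> by (auto simp: exp_msets_iff size_Diff_submset dest: in_diffD)
      have "L (a i) = (\<Sum>(\<alpha>, \<beta>)\<in>?S \<times> exp_msets M (d + N). gscale (n \<alpha> \<beta>) (K (b (\<nu> - \<alpha>, \<beta>))))"
      proof
        fix p
        show "L (a i) p = (\<Sum>(\<alpha>, \<beta>)\<in>?S \<times> exp_msets M (d + N). gscale (n \<alpha> \<beta>) (K (b (\<nu> - \<alpha>, \<beta>)))) p"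
        proof (cases "length p = M + N")
          case True
          have "L (a i) p =
              (\<Sum>\<alpha>\<in>?S. hsym N \<mu> (take M p) * hsym d \<alpha> (take M p) * hsym d (\<nu> - \<alpha>) (drop M p))"
            using True by (simp add: i La \<mu> \<nu> hsym_split[OF True \<nu>] sum_distrib_left mult.assoc)
          also have "\<dots> = (\<Sum>\<alpha>\<in>?S. \<Sum>\<beta>\<in>exp_msets M (d + N). pscale (n \<alpha> \<beta>) (K (b (\<nu> - \<alpha>, \<beta>)) p))"
            using True diff by (intro sum.cong refl)
              (auto simp: n Kb sum_distrib_left pscale_mult_right mult.commute)
          finally show ?thesis
            unfolding ap by (simp add: sum.cartesian_product gscale_def case_prod_unfold)
        \<comment> \<open>At lists of any other length both sides have the default value 0.\<close>
        next
          case False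
          then have "(\<Sum>(\<alpha>, \<beta>)\<in>?S \<times> exp_msets M (d + N). gscale (n \<alpha> \<beta>) (K (b (\<nu> - \<alpha>, \<beta>))) p) = 0"
            using diff by (intro sum.neutral) (auto simp: gscale_def Kb)
          then show ?thesis unfolding ap using False by (simp add: i La \<mu> \<nu> case_prod_unfold)
        qed
      qed
      also have "\<dots> \<in> gscale.span ((\<lambda>j. K (b j)) ` ?J)"
        unfolding case_prod_unfold using diff
        by (intro gscale.span_sum gscale.span_scale gscale.span_base imageI) auto
      finally show ?thesis .
    qed
  qed (use L K card_exp_msets in \<open>auto simp: finite_exp_msets act_tensor_in linear_end_SymSym\<close>)
qed

end
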